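(* Let $\mathcal{A}$ be a unital $C^*$-algebra. Then $\mathrm{F}^{tr}(\mathcal{A})$ is a subgroup of $\mathcal{GL}(\mathrm{T}(\mathcal{A}))$.
   Context: $\mathrm{T}(\mathcal{A})$ denotes the space of bounded traces on $\mathcal{A}$, i.e. bounded linear functionals $\varphi$ on $\mathcal{A}$ with $\varphi(ab)=\varphi(ba)$ for all $a,b\in\mathcal{A}$. $\mathcal{L}(\mathrm{T}(\mathcal{A}))$ is the algebra of bounded linear maps on $\mathrm{T}(\mathcal{A})$, and $\mathcal{GL}(\mathrm{T}(\mathcal{A}))$ is the group of invertible elements of $\mathcal{L}(\mathrm{T}(\mathcal{A}))$. A self-similar pair $(p,\Phi)$ of $\mathcal{A}$ consists of a projection $p\in M_k(\mathcal{A})$, for some $k\in\mathbb{N}$, such that the linear span of $\{a^*pb : a,b\in\mathcal{A}^k\}$ is dense in $\mathcal{A}$ (elements of $\mathcal{A}^k$ being regarded as columns), together with a $*$-isomorphism $\Phi:\mathcal{A}\to pM_k(\mathcal{A})p$. Let $\mathrm{Tr}_k$ be the unnormalized trace on $M_k(\mathbb{C})$. Each self-similar pair defines a bounded linear map $T_{(p,\Phi)}$ on $\mathrm{T}(\mathcal{A})$ by $T_{(p,\Phi)}(\varphi)=(\mathrm{Tr}_k\otimes\varphi)\circ\Phi$. Put $\mathrm{F}^{tr}(\mathcal{A})=\{T_{(p,\Phi)} : (p,\Phi)\text{ is a self-similar pair of }\mathcal{A}\}$. *)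

theory Defs
  imports "HOL-Analysis.Analysis" "HOL-Algebra.Group" "Jordan_Normal_Form.Matrix"
begin

class scaleC = scaleR +
  fixes scaleC :: "complex \<Rightarrow> 'a \<Rightarrow> 'a" (infixr \<open>*\<^sub>C\<close> 75)
  assumes scaleR_scaleC: "scaleR r = scaleC (complex_of_real r)"

text \<open>The zero algebra is admitted, which is why the unit comes from \<^class>\<open>monoid_mult\<close> and not
  from \<^class>\<open>real_normed_algebra_1\<close>; in a nonzero algebra \<open>norm 1 = 1\<close> follows from the
  C*-identity.\<close>

class unital_cstar_algebra = real_normed_algebra + banach + monoid_mult + scaleC +
  fixes star :: "'a \<Rightarrow> 'a"
  assumes scaleC_add_right: "c *\<^sub>C (x + y) = c *\<^sub>C x + c *\<^sub>C y"
    and scaleC_add_left: "(c + d) *\<^sub>C x = c *\<^sub>C x + d *\<^sub>C x"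
    and scaleC_scaleC: "c *\<^sub>C d *\<^sub>C x = (c * d) *\<^sub>C x"
    and scaleC_one: "1 *\<^sub>C x = x"
    and mult_scaleC_left: "(c *\<^sub>C x) * y = c *\<^sub>C (x * y)"
    and mult_scaleC_right: "x * (c *\<^sub>C y) = c *\<^sub>C (x * y)"
    and norm_scaleC: "norm (c *\<^sub>C x) = cmod c * norm x"
    and star_star: "star (star x) = x"
    and star_add: "star (x + y) = star x + star y"
    and star_scaleC: "star (c *\<^sub>C x) = cnj c *\<^sub>C star x"
    and star_mult: "star (x * y) = star y * star x"
    and cstar_identity: "norm (star x * x) = (norm x)\<^sup>2"

instantiation complex :: unital_cstar_algebra
begin

definition scaleC_complex :: "complex \<Rightarrow> complex \<Rightarrow> complex"
  where "scaleC_complex c x = c * x"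

definition star_complex :: "complex \<Rightarrow> complex"
  where "star_complex = cnj"

instance
  by standard
    (auto simp: scaleC_complex_def star_complex_def scaleR_conv_of_real fun_eq_iff
      algebra_simps norm_mult power2_eq_square)

end

global_interpretation complex_vector:
  vector_space "scaleC :: complex \<Rightarrow> 'a \<Rightarrow> 'a::unital_cstar_algebra"
  defines cspan = complex_vector.span
  by unfold_locales (simp_all add: scaleC_add_right scaleC_add_left scaleC_scaleC scaleC_one)


definition mat_star :: "'a::unital_cstar_algebra mat \<Rightarrow> 'a mat"
  where "mat_star x = map_mat star (transpose_mat x)"

definition mat_projection :: "nat \<Rightarrow> 'a::unital_cstar_algebra mat \<Rightarrow> bool"
  where "mat_projection k p \<longleftrightarrow> p \<in> carrier_mat k k \<and> p * p = p \<and> mat_star p = p"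

definition corner :: "nat \<Rightarrow> 'a::unital_cstar_algebra mat \<Rightarrow> 'a mat set"
  where "corner k p = {p * x * p | x. x \<in> carrier_mat k k}"

text \<open>\<open>sandwich a p b\<close> is the element \<open>a\<^sup>* p b\<close> of the algebra, for columns \<open>a\<close>, \<open>b\<close>.\<close>

definition sandwich ::
    "'a::unital_cstar_algebra vec \<Rightarrow> 'a mat \<Rightarrow> 'a vec \<Rightarrow> 'a"
  where "sandwich a p b = scalar_prod (map_vec star a) (mult_mat_vec p b)"

definition star_iso_corner ::
    "nat \<Rightarrow> 'a::unital_cstar_algebra mat \<Rightarrow> ('a \<Rightarrow> 'a mat) \<Rightarrow> bool"
  where "star_iso_corner k p \<Phi> \<longleftrightarrow>
    bij_betw \<Phi> UNIV (corner k p) \<and>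
    (\<forall>a b. \<Phi> (a + b) = \<Phi> a + \<Phi> b) \<and>
    (\<forall>c a. \<Phi> (c *\<^sub>C a) = map_mat (scaleC c) (\<Phi> a)) \<and>
    (\<forall>a b. \<Phi> (a * b) = \<Phi> a * \<Phi> b) \<and>
    (\<forall>a. \<Phi> (star a) = mat_star (\<Phi> a))"

definition self_similar_pair ::
    "'a::unital_cstar_algebra mat \<Rightarrow> ('a \<Rightarrow> 'a mat) \<Rightarrow> bool"
  where "self_similar_pair p \<Phi> \<longleftrightarrow>
    (\<exists>k\<ge>1. mat_projection k p \<and>
      closure (cspan {sandwich a p b | a b. a \<in> carrier_vec k \<and> b \<in> carrier_vec k}) = UNIV \<and>
      star_iso_corner k p \<Phi>)"


definition bounded_traces :: "('a::unital_cstar_algebra \<Rightarrow> complex) set"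
  where "bounded_traces = {\<phi>. bounded_linear \<phi> \<and>
    (\<forall>c a. \<phi> (c *\<^sub>C a) = c * \<phi> a) \<and>
    (\<forall>a b. \<phi> (a * b) = \<phi> (b * a))}"

text \<open>The bounded linear maps on the space of bounded traces (with the norm of the dual space), as
  a monoid under composition. Maps are extensional, so that two of them are equal as soon as they
  agree on all bounded traces.\<close>

definition L_traces ::
    "(('a::unital_cstar_algebra \<Rightarrow> complex) \<Rightarrow> ('a \<Rightarrow> complex)) monoid"
  where "L_traces = \<lparr>
    carrier = {S \<in> bounded_traces \<rightarrow>\<^sub>E bounded_traces.
      (\<forall>\<phi>\<in>bounded_traces. \<forall>\<psi>\<in>bounded_traces. S (\<lambda>a. \<phi> a + \<psi> a) = (\<lambda>a. S \<phi> a + S \<psi> a)) \<and>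
      (\<forall>c. \<forall>\<phi>\<in>bounded_traces. S (\<lambda>a. c * \<phi> a) = (\<lambda>a. c * S \<phi> a)) \<and>
      (\<exists>K. \<forall>\<phi>\<in>bounded_traces. onorm (S \<phi>) \<le> K * onorm \<phi>)},
    monoid.mult = compose bounded_traces,
    one = (\<lambda>\<phi>\<in>bounded_traces. \<phi>)\<rparr>"

definition GL_traces ::
    "(('a::unital_cstar_algebra \<Rightarrow> complex) \<Rightarrow> ('a \<Rightarrow> complex)) monoid"
  where "GL_traces = units_of L_traces"

text \<open>\<open>Tr\<^sub>k \<otimes> \<phi>\<close>, under the identification of \<open>M\<^sub>k(\<complex>) \<otimes> A\<close> with \<open>M\<^sub>k(A)\<close>.\<close>

definition Tr_tensor :: "('a \<Rightarrow> complex) \<Rightarrow> 'a mat \<Rightarrow> complex"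
  where "Tr_tensor \<phi> x = (\<Sum>i<dim_row x. \<phi> (x $$ (i, i)))"

text \<open>The projection of a self-similar pair enters the induced map only through its size, which is
  also the size of the values of \<open>\<Phi>\<close>.\<close>

definition induced_map ::
    "'a::unital_cstar_algebra mat \<times> ('a \<Rightarrow> 'a mat) \<Rightarrow> ('a \<Rightarrow> complex) \<Rightarrow> ('a \<Rightarrow> complex)"
  where "induced_map = (\<lambda>(p, \<Phi>). \<lambda>\<phi>\<in>bounded_traces. Tr_tensor \<phi> \<circ> \<Phi>)"

definition F_tr :: "(('a::unital_cstar_algebra \<Rightarrow> complex) \<Rightarrow> ('a \<Rightarrow> complex)) set"
  where "F_tr = {induced_map (p, \<Phi>) | p \<Phi>. self_similar_pair p \<Phi>}"

end

theory Submission
  imports Defs "HOL-Real_Asymp.Real_Asymp"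
begin

text \<open>A self-similar pair is determined by the matrix entries of \<open>\<Phi>\<close>, the projection being \<open>\<Phi> 1\<close>; since
  the algebra is unital, density of the span means that \<open>1\<close> lies in the ideal generated by the
  entries of the projection. The product of two pairs is \<open>(id\<^sub>k \<otimes> \<Psi>) \<circ> \<Phi>\<close>. For the inverse, fullness and
  polarization give vectors \<open>v\<^sub>t = p v\<^sub>t\<close> with \<open>\<Sum> v\<^sub>t\<^sup>* v\<^sub>t\<close> invertible, normalized to \<open>1\<close>; then
  \<open>\<Psi> a = (\<Phi>\<^sup>-\<^sup>1 (v\<^sub>i a v\<^sub>j\<^sup>*))\<^sub>i\<^sub>j\<close> defines a pair whose induced map is inverse to that of \<open>\<Phi>\<close> by the trace
  property.

  Both this normalization and the boundedness of the induced maps need that \<open>x\<^sup>* x\<close> is positive. No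
  spectral theory is used for it: square roots come from the binomial series, which converges
  absolutely for \<open>\<parallel>1 - h\<parallel> \<le> 1\<close>, and everything else from unitaries \<open>h + i (1 - h\<^sup>2)\<^sup>1\<^sup>/\<^sup>2\<close> and the
  C*-identity.\<close>

subsection \<open>Square roots\<close>

lemma scaleR_eq_scaleC: "r *\<^sub>R (x::'a::unital_cstar_algebra) = complex_of_real r *\<^sub>C x"
  by (simp add: scaleR_scaleC)

lemma star_scaleR [simp]: "star (r *\<^sub>R (x::'a::unital_cstar_algebra)) = r *\<^sub>R star x"
  by (simp add: scaleR_eq_scaleC star_scaleC)

lemma star_0 [simp]: "star (0::'a::unital_cstar_algebra) = 0"
  using star_add[of "0::'a" 0] by simp

lemma star_minus [simp]: "star (- x::'a::unital_cstar_algebra) = - star x"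
  using star_add[of x "- x"] by (simp add: eq_neg_iff_add_eq_0 add.commute)

lemma star_diff: "star (x - y::'a::unital_cstar_algebra) = star x - star y"
  using star_add[of x "- y"] by simp

lemma star_1 [simp]: "star (1::'a::unital_cstar_algebra) = 1"
  by (metis mult_1 star_mult star_star mult.right_neutral)

lemma star_sum: "star (sum f A) = (\<Sum>i\<in>A. star (f i :: 'a::unital_cstar_algebra))"
  by (induction A rule: infinite_finite_induct) (simp_all add: star_add)

lemma norm_star [simp]: "norm (star (x::'a::unital_cstar_algebra)) = norm x"
proof -
  have le: "norm y \<le> norm (star y)" for y :: 'a
  proof (cases "y = 0")
    case False
    have "norm y * norm y \<le> norm (star y) * norm y"
      using norm_mult_ineq[of "star y" y] by (simp add: cstar_identity power2_eq_square)
    then show ?thesis using False by simp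
  qed simp
  show ?thesis using le[of x] le[of "star x"] by (simp add: star_star)
qed

lemma bounded_linear_star: "bounded_linear (star :: 'a::unital_cstar_algebra \<Rightarrow> 'a)"
  by (rule bounded_linear_intro[of _ 1]) (simp_all add: star_add)

text \<open>The C*-identity leaves \<open>0\<close> and \<open>1\<close> as possible values; the
  value \<open>0\<close> occurs in the zero algebra.\<close>

lemma norm_one_le: "norm (1::'a::unital_cstar_algebra) \<le> 1"
proof -
  have "norm (1::'a) = (norm (1::'a))\<^sup>2"
    using cstar_identity[of "1::'a"] by simp
  then show ?thesis
    by (cases "norm (1::'a) = 0") (auto simp: power2_eq_square)
qed

lemma norm_power_le: "norm (x ^ n) \<le> norm (x::'a::unital_cstar_algebra) ^ n"
proof (induction n)
  case 0
  then show ?case using norm_one_le by simp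
next
  case (Suc n)
  have "norm (x ^ Suc n) \<le> norm x * norm (x ^ n)" by (simp add: norm_mult_ineq)
  also have "\<dots> \<le> norm x * norm x ^ n" by (intro mult_left_mono Suc.IH) simp
  finally show ?case by simp
qed

lemma star_power: "star (x ^ n) = star (x::'a::unital_cstar_algebra) ^ n"
  by (induction n) (simp_all add: star_mult power_commutes)

lemma norm_square_selfadjoint:
  assumes "star x = (x::'a::unital_cstar_algebra)"
  shows "norm (x * x) = (norm x)\<^sup>2"
  using cstar_identity[of x] assms by simp

text \<open>The inverse is the geometric series in \<open>1 - g\<close>.\<close>

lemma neumann_inverse:
  fixes g :: "'a::unital_cstar_algebra"
  assumes "norm (1 - g) < 1"
  obtains y where "g * y = 1" "y * g = 1"
proof -
  define x where "x = 1 - g"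
  have "norm (norm (x ^ n)) \<le> norm x ^ n" for n by (simp add: norm_power_le)
  then have "summable (\<lambda>n. norm (x ^ n))"
    using assms by (intro summable_comparison_test'[OF summable_geometric[of "norm x"]])
      (auto simp: x_def norm_power_le)
  then have s: "summable (\<lambda>n. x ^ n)" by (rule summable_norm_cancel)
  have split: "(\<Sum>n. x ^ n) = 1 + (\<Sum>n. x ^ Suc n)"
    using suminf_split_head[OF s] by simp
  have l: "(\<Sum>n. x ^ Suc n) = x * (\<Sum>n. x ^ n)"
    using suminf_mult[OF s, of x] by simp
  have r: "(\<Sum>n. x ^ Suc n) = (\<Sum>n. x ^ n) * x"
    using suminf_mult2[OF s, of x] by (simp only: power_Suc2)
  show thesis
  proof
    have "(1 - x) * (\<Sum>n. x ^ n) = 1"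
      using split l by (simp add: algebra_simps)
    then show "g * (\<Sum>n. x ^ n) = 1" by (simp add: x_def)
    have "(\<Sum>n. x ^ n) * (1 - x) = 1"
      using split r by (simp add: algebra_simps)
    then show "(\<Sum>n. x ^ n) * g = 1" by (simp add: x_def)
  qed
qed

text \<open>These are the Taylor coefficients of sqrt(1 - x); the sign comes from replacing x by -x
  in the binomial series of sqrt(1 + x).\<close>

definition sqrt_coeff :: "nat \<Rightarrow> real"
  where "sqrt_coeff n = (- 1) ^ n * ((1/2) gchoose n)"

lemma sqrt_coeff_0 [simp]: "sqrt_coeff 0 = 1"
  by (simp add: sqrt_coeff_def)

lemma sqrt_coeff_eq_pochhammer: "sqrt_coeff n = pochhammer (- 1/2) n / fact n"
  by (simp add: sqrt_coeff_def gbinomial_pochhammer flip: power_mult_distrib)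

lemma sqrt_coeff_Suc_nonpos: "sqrt_coeff (Suc n) \<le> 0"
proof -
  have "pochhammer (- 1/2 :: real) (Suc n) = (- 1/2) * pochhammer (1/2) n"
    by (simp add: pochhammer_rec)
  moreover have "pochhammer (1/2 :: real) n \<ge> 0"
    by (intro pochhammer_nonneg) simp
  ultimately have "pochhammer (- 1/2 :: real) (Suc n) \<le> 0" by simp
  then show ?thesis unfolding sqrt_coeff_eq_pochhammer by (intro divide_nonpos_nonneg) simp_all
qed

text \<open>The partial sums are the coefficients of sqrt(1 - x) / (1 - x) = (1 - x)^(-1/2), and
  these are nonnegative.\<close>

lemma sum_sqrt_coeff_nonneg: "(\<Sum>k\<le>n. sqrt_coeff k) \<ge> 0"
proof -
  have "(\<Sum>k\<le>n. sqrt_coeff k) = (- 1) ^ n * ((1/2 - 1) gchoose n)"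
    unfolding sqrt_coeff_def
    using gbinomial_sum_lower_neg[of "1/2::real" n] by (simp add: mult.commute)
  also have "\<dots> = pochhammer (1/2) n / fact n"
    by (simp add: gbinomial_pochhammer flip: power_mult_distrib)
  also have "\<dots> \<ge> 0"
    by (intro divide_nonneg_nonneg pochhammer_nonneg) simp_all
  finally show ?thesis .
qed

text \<open>Past the constant term no coefficient is positive, so the absolute values add up to
  \<open>1\<close> minus a partial sum. The bound gives absolute convergence up to the boundary of
  the unit ball.\<close>

lemma sum_abs_sqrt_coeff_Suc: "(\<Sum>k<n. \<bar>sqrt_coeff (Suc k)\<bar>) \<le> 1"
proof -
  have "(\<Sum>k<n. \<bar>sqrt_coeff (Suc k)\<bar>) = - (\<Sum>k<n. sqrt_coeff (Suc k))"
    using sqrt_coeff_Suc_nonpos by (simp add: sum_negf abs_of_nonpos)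
  also have "(\<Sum>k<n. sqrt_coeff (Suc k)) = (\<Sum>k<Suc n. sqrt_coeff k) - 1"
    by (simp add: sum.lessThan_Suc_shift del: sum.lessThan_Suc)
  also have "(\<Sum>k<Suc n. sqrt_coeff k) = (\<Sum>k\<le>n. sqrt_coeff k)"
    by (simp only: lessThan_Suc_atMost)
  finally show ?thesis using sum_sqrt_coeff_nonneg[of n] by simp
qed

text \<open>Coefficients are compared in sqrt(1 - x)^2 = 1 - x, by the Vandermonde identity.\<close>

lemma sqrt_coeff_convolution:
  "(\<Sum>i\<le>n. sqrt_coeff i * sqrt_coeff (n - i)) = (if n = 0 then 1 else if n = 1 then - 1 else 0)"
proof -
  have "(\<Sum>i\<le>n. sqrt_coeff i * sqrt_coeff (n - i))
      = (\<Sum>i\<le>n. (- 1) ^ n * ((1/2 gchoose i) * (1/2 gchoose (n - i))))"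
    unfolding sqrt_coeff_def
  proof (intro sum.cong refl)
    fix i assume "i \<in> {..n}"
    then have "(- 1 :: real) ^ n = (- 1) ^ i * (- 1) ^ (n - i)" by (simp flip: power_add)
    then show "(- 1) ^ i * (1/2 gchoose i) * ((- 1) ^ (n - i) * (1/2 gchoose (n - i)))
        = (- 1) ^ n * (((1/2::real) gchoose i) * (1/2 gchoose (n - i)))"
      by simp
  qed
  also have "\<dots> = (- 1) ^ n * (1 gchoose n)"
    using gbinomial_Vandermonde[of "1/2::real" "1/2" n]
    by (simp add: atMost_atLeast0 flip: sum_distrib_left)
  also have "(1::real) gchoose n = of_nat (1 choose n)"
    using binomial_gbinomial[of 1 n, where 'a = real] by simp
  finally show ?thesis
    by (cases n rule: nat.exhaust) (auto simp: binomial_eq_0)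
qed

text \<open>The root is the series of sqrt(1 - x) at \<open>x = 1 - h\<close>. Self-adjointness and
  commutation pass to it term by term; the bound on \<open>1 - d\<close> puts a self-adjoint root
  into the positive cone defined below.\<close>

lemma sqrt_exists:
  fixes h :: "'a::unital_cstar_algebra"
  assumes le: "norm (1 - h) \<le> 1"
  obtains d where "d * d = h" "norm (1 - d) \<le> 1" "star h = h \<Longrightarrow> star d = d"
    "\<And>z. z * h = h * z \<Longrightarrow> z * d = d * z"
proof -
  define x where "x = 1 - h"
  define f where "f n = sqrt_coeff n *\<^sub>R x ^ n" for n
  have xpow: "norm (x ^ n) \<le> 1" for n
    using norm_power_le[of x n] power_le_one[of "norm x" n] le by (simp add: x_def)
  have sc: "summable (\<lambda>n. \<bar>sqrt_coeff (Suc n)\<bar>)"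
    by (rule summableI_nonneg_bounded[of _ 1]) (simp_all add: sum_abs_sqrt_coeff_Suc)
  have fle: "norm (f n) \<le> \<bar>sqrt_coeff n\<bar>" for n
    unfolding f_def using xpow[of n] by (simp add: mult_left_le)
  have sfS: "summable (\<lambda>n. norm (f (Suc n)))"
    by (rule summable_comparison_test'[OF sc, of 0]) (simp add: fle)
  then have nf: "summable (\<lambda>n. norm (f n))" using summable_Suc_iff[of "\<lambda>n. norm (f n)"] by simp
  then have sf: "summable f" by (rule summable_norm_cancel)
  define d where "d = (\<Sum>n. f n)"
  have conv: "(\<Sum>i\<le>n. f i * f (n - i)) = (if n = 0 then 1 else if n = 1 then - x else 0)" for n
  proof -
    have "(\<Sum>i\<le>n. f i * f (n - i)) = (\<Sum>i\<le>n. (sqrt_coeff i * sqrt_coeff (n - i)) *\<^sub>R x ^ n)"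
      by (intro sum.cong refl) (simp add: f_def flip: power_add)
    also have "\<dots> = (\<Sum>i\<le>n. sqrt_coeff i * sqrt_coeff (n - i)) *\<^sub>R x ^ n"
      by (simp only: scaleR_left.sum)
    finally show ?thesis unfolding sqrt_coeff_convolution by (simp split: if_splits)
  qed
  have "(\<lambda>n. \<Sum>i\<le>n. f i * f (n - i)) sums (d * d)"
    unfolding d_def by (rule Cauchy_product_sums[OF nf nf])
  moreover have "(\<lambda>n. \<Sum>i\<le>n. f i * f (n - i)) sums (\<Sum>n\<in>{0, 1::nat}. if n = 0 then 1 else if n = 1 then - x else 0)"
    unfolding conv by (rule sums_finite) auto
  ultimately have "d * d = (\<Sum>n\<in>{0, 1::nat}. if n = 0 then 1 else if n = 1 then - x else 0)"
    by (rule sums_unique2)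
  then have dd: "d * d = h" by (simp add: x_def)
  have "d = 1 + (\<Sum>n. f (Suc n))"
    unfolding d_def using suminf_split_head[OF sf] by (simp add: f_def)
  then have "norm (1 - d) = norm (\<Sum>n. f (Suc n))" by simp
  also have "\<dots> \<le> (\<Sum>n. norm (f (Suc n)))" by (rule summable_norm[OF sfS])
  also have "\<dots> \<le> (\<Sum>n. \<bar>sqrt_coeff (Suc n)\<bar>)"
    by (rule suminf_le[OF _ sfS sc]) (rule fle)
  also have "\<dots> \<le> 1"
    by (rule suminf_le_const[OF sc]) (rule sum_abs_sqrt_coeff_Suc)
  finally have "norm (1 - d) \<le> 1" .
  moreover have "star d = d" if "star h = h"
  proof -
    have "star d = (\<Sum>n. star (f n))"
      unfolding d_def by (rule bounded_linear.suminf[OF bounded_linear_star sf])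
    also have "(\<lambda>n. star (f n)) = f"
      using that by (simp add: f_def star_power x_def star_diff fun_eq_iff)
    finally show ?thesis by (simp add: d_def)
  qed
  moreover have "z * d = d * z" if "z * h = h * z" for z
  proof -
    have "z * x ^ n = x ^ n * z" for n
    proof (induction n)
      case (Suc n)
      have "z * x = x * z" using that by (simp add: x_def algebra_simps)
      then show ?case by (metis Suc.IH mult.assoc power_Suc)
    qed simp
    then have "z * f n = f n * z" for n by (simp add: f_def)
    then show ?thesis
      using suminf_mult[OF sf, of z] suminf_mult2[OF sf, of z] by (simp add: d_def)
  qed
  ultimately show thesis using dd that by blast
qed

subsection \<open>The positive cone\<close>

text \<open>Let u = h + i c. Commutation cancels the cross terms in \<open>star u * u\<close>, and
  \<open>h\<close> is the real part of \<open>u\<close>, hence of no larger norm.\<close>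

lemma norm_le_norm_sum_squares:
  fixes h c :: "'a::unital_cstar_algebra"
  assumes "star h = h" "star c = c" "h * c = c * h"
  shows "(norm h)\<^sup>2 \<le> norm (h * h + c * c)"
proof -
  define u where "u = h + \<i> *\<^sub>C c"
  have su: "star u = h + (- \<i>) *\<^sub>C c"
    by (simp add: u_def star_add star_scaleC assms)
  have neg: "(- \<i>) *\<^sub>C y = - (\<i> *\<^sub>C y)" for y :: 'a
    by (rule complex_vector.scale_minus_left)
  have "star u * u = h * h + c * c"
    unfolding su unfolding u_def neg
    by (simp add: algebra_simps mult_scaleC_left mult_scaleC_right scaleC_scaleC assms(3)
        complex_vector.scale_minus_left scaleC_one)
  then have nu: "(norm u)\<^sup>2 = norm (h * h + c * c)"
    using cstar_identity[of u] by simp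
  have "2 *\<^sub>R h = u + star u" unfolding su neg by (simp add: u_def scaleR_2)
  then have "norm (2 *\<^sub>R h) \<le> norm u + norm (star u)" by (metis norm_triangle_ineq)
  then have "norm h \<le> norm u" by simp
  then show ?thesis unfolding nu[symmetric] by (rule power_mono) simp
qed

text \<open>With \<open>c\<close> the square root of \<open>1 - h * h\<close>, the element h + i c
  is unitary. So \<open>c\<close> has norm at most \<open>1\<close>, and the C*-identity carries
  this bound over to \<open>c * c\<close>.\<close>

lemma norm_one_minus_square:
  fixes h :: "'a::unital_cstar_algebra"
  assumes sa: "star h = h" and le: "norm h \<le> 1"
  shows "norm (1 - h * h) \<le> 1"
proof -
  have "norm (1 - (1 - h * h)) \<le> 1"
    using norm_square_selfadjoint[OF sa] le by (simp add: power_le_one)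
  then obtain c where c: "c * c = 1 - h * h" "star (1 - h * h) = 1 - h * h \<Longrightarrow> star c = c"
    "\<And>z. z * (1 - h * h) = (1 - h * h) * z \<Longrightarrow> z * c = c * z"
    by (rule sqrt_exists) metis
  have sc: "star c = c" by (rule c(2)) (simp add: star_diff star_mult sa)
  have "c * h = h * c" using c(3)[of h] by (simp add: algebra_simps)
  then have "(norm c)\<^sup>2 \<le> norm (c * c + h * h)"
    by (intro norm_le_norm_sum_squares sc sa)
  also have "\<dots> \<le> 1" using norm_one_le by (simp add: c(1))
  finally show ?thesis using norm_square_selfadjoint[OF sc] by (simp add: c(1))
qed

text \<open>Positivity is expressed through the norm, so that closure under sums is immediate.\<close>

definition positive_cone :: "'a::unital_cstar_algebra set"
  where "positive_cone = {h. star h = h \<and> (\<exists>t>0. norm (1 - t *\<^sub>R h) \<le> 1)}"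

lemma positive_coneI: "star h = h \<Longrightarrow> t > 0 \<Longrightarrow> norm (1 - t *\<^sub>R h) \<le> 1 \<Longrightarrow> h \<in> positive_cone"
  by (auto simp: positive_cone_def)

lemma positive_cone_zero: "0 \<in> positive_cone"
  by (rule positive_coneI[of _ 1]) (simp_all add: norm_one_le)

lemma positive_cone_scaleR:
  assumes "h \<in> positive_cone" "r > 0" shows "r *\<^sub>R h \<in> positive_cone"
proof -
  obtain t where "t > 0" "norm (1 - t *\<^sub>R h) \<le> 1" "star h = h"
    using assms by (auto simp: positive_cone_def)
  then show ?thesis using assms(2) by (intro positive_coneI[of _ "t / r"]) simp_all
qed

text \<open>For the parameter \<open>t * s / (t + s)\<close>, the element to be estimated is the
  convex combination of \<open>1 - t *\<^sub>R a\<close> and \<open>1 - s *\<^sub>R b\<close> with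
  weights \<open>s / (t + s)\<close> and \<open>t / (t + s)\<close>.\<close>

lemma positive_cone_add:
  assumes "a \<in> positive_cone" "b \<in> positive_cone" shows "a + b \<in> positive_cone"
proof -
  obtain t where t: "t > 0" "norm (1 - t *\<^sub>R a) \<le> 1" and a: "star a = a"
    using assms by (auto simp: positive_cone_def)
  obtain s where s: "s > 0" "norm (1 - s *\<^sub>R b) \<le> 1" and b: "star b = b"
    using assms by (auto simp: positive_cone_def)
  have pos: "t + s > 0" using t s by simp
  have "(t + s) *\<^sub>R (1 - (t * s / (t + s)) *\<^sub>R (a + b)) = (t + s) *\<^sub>R 1 - (t * s) *\<^sub>R (a + b)"
    using pos by (simp add: scaleR_diff_right)
  also have "\<dots> = s *\<^sub>R (1 - t *\<^sub>R a) + t *\<^sub>R (1 - s *\<^sub>R b)"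
    by (simp add: algebra_simps)
  finally have "(t + s) *\<^sub>R (1 - (t * s / (t + s)) *\<^sub>R (a + b)) = s *\<^sub>R (1 - t *\<^sub>R a) + t *\<^sub>R (1 - s *\<^sub>R b)" .
  then have "(t + s) * norm (1 - (t * s / (t + s)) *\<^sub>R (a + b))
      = norm (s *\<^sub>R (1 - t *\<^sub>R a) + t *\<^sub>R (1 - s *\<^sub>R b))"
    using pos by (metis abs_of_pos norm_scaleR)
  also have "\<dots> \<le> s * 1 + t * 1"
    using t s by (intro order_trans[OF norm_triangle_ineq] add_mono) (simp_all add: mult_left_le)
  finally have "norm (1 - (t * s / (t + s)) *\<^sub>R (a + b)) \<le> 1"
    using pos by (simp add: add.commute)
  then show ?thesis
    using t s a b by (intro positive_coneI[of _ "t * s / (t + s)"]) (simp_all add: star_add)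
qed

lemma positive_cone_sum:
  assumes "\<And>i. i \<in> A \<Longrightarrow> f i \<in> positive_cone" shows "sum f A \<in> positive_cone"
  using assms
  by (induction A rule: infinite_finite_induct) (simp_all add: positive_cone_zero positive_cone_add)

lemma positive_cone_square:
  fixes h :: "'a::unital_cstar_algebra"
  assumes "star h = h" shows "h * h \<in> positive_cone"
proof -
  \<comment> \<open>The summand \<open>1\<close> keeps the denominator positive also for
    \<open>h = 0\<close>.\<close>
  define r where "r = 1 / (1 + norm h)"
  have r: "r > 0" by (simp add: r_def add_pos_nonneg)
  have "norm (r *\<^sub>R h) \<le> 1" using r by (simp add: r_def divide_le_eq add_pos_nonneg)
  then have "norm (1 - (r *\<^sub>R h) * (r *\<^sub>R h)) \<le> 1"
    by (intro norm_one_minus_square) (simp_all add: assms)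
  then show ?thesis
    using r assms by (intro positive_coneI[of _ "r * r"]) (simp_all add: star_mult)
qed

text \<open>The root of \<open>t *\<^sub>R h\<close> is divided by the root of \<open>t\<close>; the
  bound on \<open>1 - d\<close> keeps it in the cone.\<close>

lemma positive_cone_sqrt:
  fixes h :: "'a::unital_cstar_algebra"
  assumes "h \<in> positive_cone"
  obtains d where "d * d = h" "d \<in> positive_cone" "star d = d"
    "\<And>z. z * h = h * z \<Longrightarrow> z * d = d * z"
proof -
  obtain t where t: "t > 0" "norm (1 - t *\<^sub>R h) \<le> 1" and sa: "star h = h"
    using assms by (auto simp: positive_cone_def)
  obtain d where d: "d * d = t *\<^sub>R h" "norm (1 - d) \<le> 1"
    "star (t *\<^sub>R h) = t *\<^sub>R h \<Longrightarrow> star d = d"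
    "\<And>z. z * (t *\<^sub>R h) = (t *\<^sub>R h) * z \<Longrightarrow> z * d = d * z"
    using sqrt_exists[OF t(2)] by metis
  have sd: "star d = d" by (rule d(3)) (simp add: sa)
  define s where "s = 1 / sqrt t"
  have s: "s > 0" "s * (s * t) = 1" using t(1) by (simp_all add: s_def)
  show thesis
  proof
    show "(s *\<^sub>R d) * (s *\<^sub>R d) = h"
      using s(2) by (simp only: mult_scaleR_left mult_scaleR_right d(1) scaleR_scaleR scaleR_one)
    show "s *\<^sub>R d \<in> positive_cone"
      using d(2) sd s(1) by (intro positive_coneI[of _ "1 / s"]) simp_all
    show "star (s *\<^sub>R d) = s *\<^sub>R d" by (simp add: sd)
    show "z * (s *\<^sub>R d) = (s *\<^sub>R d) * z" if "z * h = h * z" for z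
      using d(4)[of z] that by simp
  qed
qed

text \<open>The roots \<open>d\<close> of \<open>h\<close> and \<open>e\<close> of
  \<open>- h\<close> commute and their squares add up to \<open>0\<close>, which forces
  \<open>d = 0\<close>.\<close>

lemma positive_cone_antisym:
  assumes "h \<in> positive_cone" "- h \<in> positive_cone" shows "h = 0"
proof -
  obtain d where d: "d * d = h" "star d = d" "\<And>z. z * h = h * z \<Longrightarrow> z * d = d * z"
    using positive_cone_sqrt[OF assms(1)] by metis
  obtain e where e: "e * e = - h" "star e = e" "\<And>z. z * (- h) = (- h) * z \<Longrightarrow> z * e = e * z"
    using positive_cone_sqrt[OF assms(2)] by metis
  have "d * e = e * d"
  proof -
    have "d * h = h * d" by (metis d(1) mult.assoc)
    then have "d * (- h) = (- h) * d" by simp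
    then show ?thesis by (rule e(3))
  qed
  then have "(norm d)\<^sup>2 \<le> norm (d * d + e * e)"
    by (intro norm_le_norm_sum_squares d(2) e(2))
  then have "d = 0" by (simp add: d(1) e(1))
  then show ?thesis using d(1) by simp
qed

text \<open>For \<open>r > 1\<close> exponential growth beats linear growth. Exponents are
  restricted to powers of two because repeated squaring is what the C*-identity controls.\<close>

lemma le_one_if_power_linear:
  fixes r C :: real
  assumes "r \<ge> 0" "\<And>m. r ^ (2 ^ m) \<le> 1 + 2 ^ m * C" shows "r \<le> 1"
proof (rule ccontr)
  assume "\<not> r \<le> 1"
  then have r: "r > 1" by simp
  have "(\<lambda>n::nat. (1 + real n * C) / r ^ n) \<longlonglongrightarrow> 0"
    using r by real_asymp
  moreover have "filterlim (\<lambda>m::nat. (2::nat) ^ m) at_top at_top"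
    by (rule filterlim_subseq) (simp add: strict_mono_def)
  ultimately have "(\<lambda>m::nat. (1 + real (2 ^ m) * C) / r ^ (2 ^ m)) \<longlonglongrightarrow> 0"
    by (rule filterlim_compose)
  then have "eventually (\<lambda>m. (1 + real (2 ^ m) * C) / r ^ (2 ^ m) < 1) sequentially"
    by (rule order_tendstoD) simp
  then obtain m where "(1 + real (2 ^ m) * C) / r ^ (2 ^ m) < 1"
    by (auto simp: eventually_sequentially)
  then show False using assms(2)[of m] r by (simp add: divide_less_eq)
qed

text \<open>\<open>1 - x\<^sup>* x\<close> and \<open>1 - x x\<^sup>*\<close> have powers of comparable norm.\<close>

lemma norm_one_minus_star_mult:
  fixes x :: "'a::unital_cstar_algebra"
  assumes "norm (1 - x * star x) \<le> 1"
  shows "norm (1 - star x * x) \<le> 1"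
proof -
  define y where "y = 1 - x * star x"
  define z where "z = 1 - star x * x"
  have sz: "star (z ^ n) = z ^ n" for n
    by (simp add: star_power z_def star_diff star_mult star_star)
  \<comment> \<open>\<open>star x\<close> intertwines \<open>z\<close> and \<open>y\<close>, so
    powers of one turn into powers of the other.\<close>
  have zx: "z ^ n * star x = star x * y ^ n" for n
  proof (induction n)
    case (Suc n)
    have "z * star x = star x * y" by (simp add: z_def y_def algebra_simps)
    then show ?case by (metis Suc.IH mult.assoc power_Suc power_Suc2)
  qed simp
  \<comment> \<open>A telescoping sum. As the powers of \<open>y\<close> stay bounded by
    \<open>1\<close>, the norms of the powers of \<open>z\<close> grow at most linearly.\<close>
  have pow: "1 - z ^ n = star x * (\<Sum>j<n. y ^ j) * x" for n
  proof (induction n)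
    case (Suc n)
    have "1 - z ^ Suc n = (1 - z ^ n) + z ^ n * (1 - z)"
      by (simp only: power_Suc2) (simp add: algebra_simps)
    also have "z ^ n * (1 - z) = star x * y ^ n * x"
      using zx[of n] by (simp add: z_def flip: mult.assoc)
    finally show ?case unfolding Suc.IH by (simp add: algebra_simps)
  qed simp
  have "norm (y ^ j) \<le> 1" for j
    using norm_power_le[of y j] power_le_one[of "norm y" j] assms by (simp add: y_def)
  then have ysum: "norm (\<Sum>j<n. y ^ j) \<le> real n" for n
    using sum_norm_le[of "{..<n}" "\<lambda>j. y ^ j" "\<lambda>_. 1"] by simp
  have bound: "norm (z ^ n) \<le> 1 + real n * (norm x)\<^sup>2" for n
  proof -
    have "norm (1 - z ^ n) \<le> norm x * real n * norm x"
      unfolding pow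
      by (intro order_trans[OF norm_mult_ineq] mult_right_mono order_trans[OF norm_mult_ineq])
        (simp_all add: mult_left_mono ysum)
    moreover have "norm (z ^ n) \<le> norm (1::'a) + norm (1 - z ^ n)"
      by (metis norm_triangle_ineq4 diff_diff_eq2 add_diff_cancel_left')
    ultimately show ?thesis using norm_one_le[where 'a = 'a] by (simp add: power2_eq_square mult.commute mult.left_commute)
  qed
  \<comment> \<open>For self-adjoint elements squaring squares the norm, so the linear bound becomes
    one on powers of \<open>norm z\<close>.\<close>
  have "norm (z ^ (2 ^ m)) = norm z ^ (2 ^ m)" for m
  proof (induction m)
    case (Suc m)
    have "norm (z ^ (2 ^ Suc m)) = norm (z ^ (2 ^ m) * z ^ (2 ^ m))"
      by (simp add: mult_2 flip: power_add)
    also have "\<dots> = (norm z ^ (2 ^ m))\<^sup>2"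
      using norm_square_selfadjoint[OF sz] Suc.IH by metis
    finally show ?case by (simp add: mult.commute flip: power_mult)
  qed simp
  then have "norm z ^ (2 ^ m) \<le> 1 + 2 ^ m * (norm x)\<^sup>2" for m
    using bound[of "2 ^ m"] by simp
  then have "norm z \<le> 1"
    by (rule le_one_if_power_linear[OF norm_ge_zero])
  then show ?thesis by (simp add: z_def)
qed

text \<open>Scaling \<open>x\<close> by the root of \<open>t\<close> reduces this to the preceding
  norm estimate.\<close>

lemma positive_cone_star_mult_swap:
  fixes x :: "'a::unital_cstar_algebra"
  assumes "x * star x \<in> positive_cone" shows "star x * x \<in> positive_cone"
proof -
  obtain t where t: "t > 0" "norm (1 - t *\<^sub>R (x * star x)) \<le> 1"
    using assms by (auto simp: positive_cone_def)
  define y where "y = sqrt t *\<^sub>R x"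
  have "norm (1 - y * star y) \<le> 1" using t by (simp add: y_def)
  then have "norm (1 - star y * y) \<le> 1" by (rule norm_one_minus_star_mult)
  then show ?thesis
    using t(1) by (intro positive_coneI[of _ t]) (simp_all add: y_def star_mult star_star)
qed

text \<open>For \<open>t = x * n\<close>, the element \<open>star t * t\<close> is minus a square,
  while \<open>star t * t + t * star t\<close> is a positive combination of squares. So
  \<open>t * star t\<close> is positive, hence \<open>star t * t\<close> is too, and antisymmetry
  leaves \<open>t = 0\<close>.\<close>

theorem positive_cone_star_mult:
  fixes x :: "'a::unital_cstar_algebra"
  shows "star x * x \<in> positive_cone"
proof -
  define a where "a = star x * x"
  have sa: "star a = a" by (simp add: a_def star_mult star_star)
  \<comment> \<open>\<open>b\<close> is the absolute value of \<open>a\<close>.\<close>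
  obtain b where b: "b * b = a * a" "b \<in> positive_cone" "star b = b"
    "\<And>z. z * (a * a) = (a * a) * z \<Longrightarrow> z * b = b * z"
    using positive_cone_sqrt[OF positive_cone_square[OF sa]] by metis
  have ab: "a * b = b * a" by (rule b(4)) (simp add: mult.assoc)
  obtain d where d: "d * d = b" "star d = d" "\<And>z. z * b = b * z \<Longrightarrow> z * d = d * z"
    using positive_cone_sqrt[OF b(2)] by metis
  txt \<open>\<open>n\<close> is twice the negative part of \<open>a\<close>, and the goal is \<open>n = 0\<close>.\<close>
  define n where "n = b - a"
  have sn: "star n = n" by (simp add: n_def star_diff sa b(3))
  have na: "n * a = - (n * b)" by (simp add: n_def algebra_simps b(1) ab)
  have nd: "n * d = d * n"
    by (rule d(3)) (simp add: n_def algebra_simps ab)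
  define k where "k = d * n"
  have sk: "star k = k" by (simp add: k_def star_mult d(2) sn nd)
  define t where "t = x * n"
  have tt: "star t * t = - (k * k)"
  proof -
    have "star t * t = n * a * n"
      by (simp add: t_def a_def star_mult sn mult.assoc)
    also have "\<dots> = - (n * d * (d * n))" by (simp add: na mult.assoc flip: d(1))
    finally show ?thesis by (simp add: k_def nd)
  qed
  \<comment> \<open>Up to sign, \<open>u\<close> and \<open>w\<close> are twice the real and
    imaginary parts of \<open>t\<close>.\<close>
  define u where "u = t + star t"
  define w where "w = \<i> *\<^sub>C (t - star t)"
  have su: "star u = u" by (simp add: u_def star_add star_star add.commute)
  have sw: "star w = w"
    by (simp add: w_def star_scaleC star_diff star_star complex_vector.scale_minus_left
        flip: complex_vector.scale_minus_right)
  have ww: "w * w = - ((t - star t) * (t - star t))"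
    by (simp add: w_def mult_scaleC_left mult_scaleC_right scaleC_scaleC
        complex_vector.scale_minus_left scaleC_one)
  have "t * star t = (1/2) *\<^sub>R (u * u + w * w) + k * k"
  proof -
    have "u * u + w * w = 2 *\<^sub>R (t * star t + star t * t)"
      unfolding ww u_def by (simp add: algebra_simps scaleR_2)
    then show ?thesis by (simp add: tt)
  qed
  also have "\<dots> \<in> positive_cone"
    by (intro positive_cone_add positive_cone_scaleR positive_cone_square su sw sk) simp
  finally have "star t * t \<in> positive_cone" by (rule positive_cone_star_mult_swap)
  then have "k * k = 0"
    unfolding tt by (intro positive_cone_antisym positive_cone_square sk)
  then have "t = 0" using cstar_identity[of t] by (simp add: tt)
  then have "a * n = 0" by (simp add: t_def a_def mult.assoc)
  moreover have "a * n = n * a" by (simp add: n_def algebra_simps ab)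
  ultimately have "n * a = 0" by simp
  with na have "n * n = 0" by (simp add: n_def algebra_simps)
  then have "n = 0" using norm_square_selfadjoint[OF sn] by simp
  then show ?thesis using b(2) by (simp add: n_def a_def)
qed

text \<open>For \<open>r > norm (x + y)\<close> also \<open>r *\<^sub>R 1 - x\<close> is positive.
  It and \<open>x\<close> have commuting roots whose squares add up to \<open>r *\<^sub>R 1\<close>,
  which bounds the norm of \<open>x\<close> by \<open>r\<close>.\<close>

lemma norm_le_add_positive:
  fixes x y :: "'a::unital_cstar_algebra"
  assumes "x \<in> positive_cone" "y \<in> positive_cone" shows "norm x \<le> norm (x + y)"
proof (rule dense_ge)
  fix r assume r: "norm (x + y) < r"
  then have r0: "r > 0" using norm_ge_zero[of "x + y"] by linarith
  have sxy: "star (x + y) = x + y" using positive_cone_add[OF assms] by (simp add: positive_cone_def)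
  have "r *\<^sub>R 1 - (x + y) \<in> positive_cone"
    using r r0 by (intro positive_coneI[of _ "1 / r"]) (simp_all add: star_diff sxy scaleR_diff_right)
  from positive_cone_add[OF this assms(2)] have "r *\<^sub>R 1 - x \<in> positive_cone" by simp
  then obtain l where l: "l * l = r *\<^sub>R 1 - x" "star l = l"
    "\<And>z. z * (r *\<^sub>R 1 - x) = (r *\<^sub>R 1 - x) * z \<Longrightarrow> z * l = l * z"
    using positive_cone_sqrt by metis
  obtain f where f: "f * f = x" "star f = f" "\<And>z. z * x = x * z \<Longrightarrow> z * f = f * z"
    using positive_cone_sqrt[OF assms(1)] by metis
  have "f * l = l * f"
  proof -
    have "f * x = x * f" by (metis f(1) mult.assoc)
    then have "f * (r *\<^sub>R 1 - x) = (r *\<^sub>R 1 - x) * f"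
      by (simp add: right_diff_distrib left_diff_distrib)
    then show ?thesis by (rule l(3))
  qed
  then have "(norm f)\<^sup>2 \<le> norm (f * f + l * l)" by (intro norm_le_norm_sum_squares f(2) l(2))
  also have "\<dots> \<le> r" using norm_one_le[where 'a = 'a] r0 by (simp add: f(1) l(1) mult_left_le)
  finally show "norm x \<le> r" using norm_square_selfadjoint[OF f(2)] by (simp add: f(1))
qed

text \<open>The element sought is (c + h)^(-1/2). With \<open>r = 1 + c * t\<close>, the multiple
  \<open>g\<close> of \<open>c *\<^sub>R 1 + h\<close> satisfies
  \<open>r *\<^sub>R (1 - g) = 1 - t *\<^sub>R h\<close>, so \<open>1 - g\<close> has norm below
  \<open>1\<close>: both the Neumann inverse and the root of \<open>g\<close> exist.\<close>

lemma inverse_sqrt_exists: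
  fixes h :: "'a::unital_cstar_algebra"
  assumes h: "h \<in> positive_cone" and c: "c > 0"
  obtains e where "star e = e" "e * (c *\<^sub>R 1 + h) * e = 1"
proof -
  obtain t where t: "t > 0" "norm (1 - t *\<^sub>R h) \<le> 1" and sh: "star h = h"
    using h by (auto simp: positive_cone_def)
  define r where "r = 1 + c * t"
  have r: "r > 1" using t c by (simp add: r_def)
  define g where "g = (t / r) *\<^sub>R (c *\<^sub>R 1 + h)"
  have "r *\<^sub>R (1 - g) = (r - t * c) *\<^sub>R 1 - t *\<^sub>R h"
    using r by (simp add: g_def scaleR_diff_right scaleR_add_right scaleR_diff_left)
  also have "r - t * c = 1" by (simp add: r_def)
  finally have "r *\<^sub>R (1 - g) = 1 - t *\<^sub>R h" by simp
  then have "norm (r *\<^sub>R (1 - g)) = norm (1 - t *\<^sub>R h)" by simp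
  then have "r * norm (1 - g) = norm (1 - t *\<^sub>R h)" using r by simp
  then have "r * norm (1 - g) < r * 1" using t(2) r by linarith
  then have lt: "norm (1 - g) < 1" using r by simp
  obtain y where y: "g * y = 1" "y * g = 1" using neumann_inverse[OF lt] by metis
  have sg: "star g = g" by (simp add: g_def star_add sh)
  obtain d where d: "d * d = g" "star g = g \<Longrightarrow> star d = d"
    using sqrt_exists[OF less_imp_le[OF lt]] by metis
  have sd: "star d = d" using d(2) sg .
  have "star y * g = 1" by (metis sg star_1 star_mult y(1))
  then have sy: "star y = y" by (metis mult.assoc mult_1_left mult_1_right y(1))
  have "d * g = g * d" by (simp add: mult.assoc flip: d(1))
  then have dy: "d * y = y * d" by (metis mult.assoc mult_1_left mult_1_right y)
  define s where "s = sqrt (t / r)"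
  have s: "s * s = t / r" using t r by (simp add: s_def)
  have "d * y * g * (d * y) = d * (y * g) * d * y" by (simp only: mult.assoc)
  then have one: "d * y * g * (d * y) = 1" by (simp add: y d(1))
  show thesis
  proof
    show "star (s *\<^sub>R (d * y)) = s *\<^sub>R (d * y)" by (simp add: star_mult sd sy dy)
    have "s *\<^sub>R (d * y) * (c *\<^sub>R 1 + h) * s *\<^sub>R (d * y) = d * y * ((s * s) *\<^sub>R (c *\<^sub>R 1 + h)) * (d * y)"
      by (simp only: mult_scaleR_left mult_scaleR_right scaleR_scaleR)
    then show "s *\<^sub>R (d * y) * (c *\<^sub>R 1 + h) * s *\<^sub>R (d * y) = 1"
      using one by (simp only: s flip: g_def)
  qed
qed

subsection \<open>Full corners in terms of matrix entries\<close>

inductive_set ideal_gen :: "'a::ring set \<Rightarrow> 'a set" for S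
  where
    base: "s \<in> S \<Longrightarrow> s \<in> ideal_gen S"
  | zero: "0 \<in> ideal_gen S"
  | add: "x \<in> ideal_gen S \<Longrightarrow> y \<in> ideal_gen S \<Longrightarrow> x + y \<in> ideal_gen S"
  | lmult: "x \<in> ideal_gen S \<Longrightarrow> a * x \<in> ideal_gen S"
  | rmult: "x \<in> ideal_gen S \<Longrightarrow> x * a \<in> ideal_gen S"

lemma ideal_gen_sum: "(\<And>i. i \<in> A \<Longrightarrow> f i \<in> ideal_gen S) \<Longrightarrow> sum f A \<in> ideal_gen S"
  by (induction A rule: infinite_finite_induct) (auto intro: ideal_gen.intros)

lemma ideal_gen_minimal: "S \<subseteq> ideal_gen T \<Longrightarrow> x \<in> ideal_gen S \<Longrightarrow> x \<in> ideal_gen T"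
  by (rotate_tac, induction rule: ideal_gen.induct) (auto intro: ideal_gen.intros)

lemma sandwich_eq:
  assumes "p \<in> carrier_mat k k" "a \<in> carrier_vec k" "b \<in> carrier_vec k"
  shows "sandwich a p b
    = (\<Sum>i<k. \<Sum>j<k. star (vec_index a i) * p $$ (i, j) * vec_index b j)"
  using assms unfolding sandwich_def scalar_prod_def
  by (auto simp: atLeast0LessThan scalar_prod_def sum_distrib_left mult.assoc intro!: sum.cong)

text \<open>A dense span contains an element at distance less than \<open>1\<close> from
  \<open>1\<close>, which is invertible and lies in the algebraic ideal. Conversely, vectors with a
  single nonzero coordinate realize every \<open>c * p $$ (i, j) * d\<close> as a sandwich.\<close>

lemma full_iff_ideal:
  fixes p :: "'a::unital_cstar_algebra mat"
  assumes p: "p \<in> carrier_mat k k"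
  shows "closure (cspan {sandwich a p b | a b. a \<in> carrier_vec k \<and> b \<in> carrier_vec k}) = UNIV
    \<longleftrightarrow> 1 \<in> ideal_gen {p $$ (i, j) | i j. i < k \<and> j < k}"
    (is "closure (cspan ?S) = UNIV \<longleftrightarrow> 1 \<in> ideal_gen ?E")
proof
  assume dense: "closure (cspan ?S) = UNIV"
  have "?S \<subseteq> ideal_gen ?E"
  proof safe
    fix a b :: "'a Matrix.vec" assume ab: "a \<in> carrier_vec k" "b \<in> carrier_vec k"
    show "sandwich a p b \<in> ideal_gen ?E"
      unfolding sandwich_eq[OF p ab]
      by (intro ideal_gen_sum ideal_gen.rmult ideal_gen.lmult ideal_gen.base) auto
  qed
  moreover have "complex_vector.subspace (ideal_gen ?E)"
  proof (rule complex_vector.subspaceI)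
    show "c *\<^sub>C x \<in> ideal_gen ?E" if "x \<in> ideal_gen ?E" for c x
      using ideal_gen.lmult[OF that, of "c *\<^sub>C 1"] by (simp add: mult_scaleC_left)
  qed (auto intro: ideal_gen.intros)
  ultimately have sub: "cspan ?S \<subseteq> ideal_gen ?E" by (rule complex_vector.span_minimal)
  have "(1::'a) \<in> closure (cspan ?S)" using dense by simp
  then have "\<exists>g\<in>cspan ?S. dist g 1 < 1"
    by (rule closure_approachable[THEN iffD1, rule_format]) simp
  then obtain g where g: "g \<in> cspan ?S" "dist g 1 < 1" by (rule bexE)
  then have "norm (1 - g) < 1" by (simp add: dist_norm norm_minus_commute)
  then obtain y where "g * y = 1" by (rule neumann_inverse)
  then show "1 \<in> ideal_gen ?E" using ideal_gen.rmult[OF subsetD[OF sub g(1)], of y] by simp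
next
  assume one: "1 \<in> ideal_gen ?E"
  \<comment> \<open>The outer factors \<open>c\<close> and \<open>d\<close> stay arbitrary in order
    to absorb the multiplications of the ideal.\<close>
  have "c * z * d \<in> cspan ?S" if "z \<in> ideal_gen ?E" for z c d
    using that
  proof (induction arbitrary: c d rule: ideal_gen.induct)
    case (base z)
    then obtain i j where ij: "i < k" "j < k" "z = p $$ (i, j)" by blast
    define a where "a = vec k (\<lambda>s. if s = i then star c else 0)"
    define b where "b = vec k (\<lambda>s. if s = j then d else 0)"
    have ab: "a \<in> carrier_vec k" "b \<in> carrier_vec k" by (simp_all add: a_def b_def)
    have "sandwich a p b = (\<Sum>i'<k. \<Sum>j'<k. if j' = j then (if i' = i then c * p $$ (i, j) * d else 0) else 0)"
      unfolding sandwich_eq[OF p ab]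
      by (intro sum.cong refl) (auto simp: a_def b_def star_star)
    also have "\<dots> = c * z * d" using ij by simp
    finally show ?case using ab by (intro complex_vector.span_base CollectI exI[of _ a] exI[of _ b] conjI) simp_all
  next
    case zero
    show ?case by (simp add: complex_vector.span_zero)
  next
    case (add x y)
    have "c * x * d + c * y * d \<in> cspan ?S" by (intro complex_vector.span_add add.IH)
    then show ?case by (simp add: algebra_simps)
  next
    case (lmult x a)
    show ?case using lmult.IH[of "c * a" d] by (simp add: mult.assoc)
  next
    case (rmult x a)
    show ?case using rmult.IH[of c "a * d"] by (simp add: mult.assoc)
  qed
  from this[OF one, of _ 1] have "cspan ?S = UNIV" by auto
  then show "closure (cspan ?S) = UNIV" by simp
qed

text \<open>Here \<open>F a i j\<close> is the \<open>(i, j)\<close> entry of \<open>\<Phi> a\<close>, and the projection is \<open>\<Phi> 1\<close>.\<close>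

locale full_corner =
  fixes k :: nat and F :: "'a::unital_cstar_algebra \<Rightarrow> nat \<Rightarrow> nat \<Rightarrow> 'a"
  assumes size_pos: "k > 0"
    and add: "i < k \<Longrightarrow> j < k \<Longrightarrow> F (a + b) i j = F a i j + F b i j"
    and scaleC: "i < k \<Longrightarrow> j < k \<Longrightarrow> F (c *\<^sub>C a) i j = c *\<^sub>C F a i j"
    and mult: "i < k \<Longrightarrow> j < k \<Longrightarrow> F (a * b) i j = (\<Sum>l<k. F a i l * F b l j)"
    and star: "i < k \<Longrightarrow> j < k \<Longrightarrow> F (star a) i j = star (F a j i)"
    and eqI: "(\<And>i j. i < k \<Longrightarrow> j < k \<Longrightarrow> F a i j = F b i j) \<Longrightarrow> a = b"
    and surj: "\<exists>a. \<forall>i<k. \<forall>j<k. F a i j = (\<Sum>m<k. (\<Sum>l<k. F 1 i l * x l m) * F 1 m j)"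
    and full: "1 \<in> ideal_gen {F 1 i j | i j. i < k \<and> j < k}"
begin

lemma zero: "i < k \<Longrightarrow> j < k \<Longrightarrow> F 0 i j = 0"
  using add[of i j 0 0] by simp

lemma sum: "i < k \<Longrightarrow> j < k \<Longrightarrow> F (sum f A) i j = (\<Sum>x\<in>A. F (f x) i j)"
  by (induction A rule: infinite_finite_induct) (simp_all add: zero add)

lemma scaleR: "i < k \<Longrightarrow> j < k \<Longrightarrow> F (r *\<^sub>R a) i j = r *\<^sub>R F a i j"
  by (simp add: scaleR_eq_scaleC scaleC)

lemma unit_left: "i < k \<Longrightarrow> j < k \<Longrightarrow> (\<Sum>l<k. F 1 i l * F a l j) = F a i j"
  using mult[of i j 1 a] by simp

lemma unit_right: "i < k \<Longrightarrow> j < k \<Longrightarrow> (\<Sum>l<k. F a i l * F 1 l j) = F a i j"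
  using mult[of i j a 1] by simp

lemma star_unit: "i < k \<Longrightarrow> j < k \<Longrightarrow> star (F 1 i j) = F 1 j i"
  using star[of j i 1] by simp

text \<open>The preimage of the matrix \<open>x\<close> under \<open>F\<close>, meaningful when
  \<open>x\<close> is fixed by \<open>F 1\<close> from both sides.\<close>

definition lift :: "(nat \<Rightarrow> nat \<Rightarrow> 'a) \<Rightarrow> 'a"
  where "lift x = (SOME a. \<forall>i<k. \<forall>j<k. F a i j = x i j)"

lemma F_lift:
  assumes "\<And>i j. i < k \<Longrightarrow> j < k \<Longrightarrow> (\<Sum>l<k. F 1 i l * x l j) = x i j"
    and "\<And>i j. i < k \<Longrightarrow> j < k \<Longrightarrow> (\<Sum>l<k. x i l * F 1 l j) = x i j"
    and "i < k" "j < k"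
  shows "F (lift x) i j = x i j"
proof -
  have "\<exists>a. \<forall>i<k. \<forall>j<k. F a i j = x i j"
    using surj[of x] assms(1,2) by simp
  from someI_ex[OF this] show ?thesis using assms(3,4) by (simp add: lift_def)
qed

text \<open>For \<open>norm a \<le> 1\<close> write \<open>1 = star a * a + star d * d\<close>. Then
  \<open>F 1 i i\<close> is a sum of positive elements, one of which is
  \<open>star (F a i i) * F a i i\<close>; monotonicity of the norm and the C*-identity give the
  bound.\<close>

lemma bounded_diagonal:
  assumes i: "i < k"
  shows "norm (F a i i) \<le> sqrt (norm (F 1 i i)) * norm a"
proof -
  have unit: "(norm (F a i i))\<^sup>2 \<le> norm (F 1 i i)" if le: "norm a \<le> 1" for a
  proof -
    have "norm (star a * a) \<le> 1" using le by (simp add: cstar_identity power_le_one)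
    then have "1 - star a * a \<in> positive_cone"
      by (intro positive_coneI[of _ 1]) (simp_all add: star_diff star_mult star_star)
    then obtain d where d: "d * d = 1 - star a * a" "star d = d"
      using positive_cone_sqrt by metis
    define q where "q b l = star (F b l i) * F b l i" for b l
    have q: "F (star b * b) i i = (\<Sum>l<k. q b l)" for b
      using i by (simp add: mult star q_def)
    have pos: "q b l \<in> positive_cone" for b l
      unfolding q_def by (rule positive_cone_star_mult)
    have "star a * a + star d * d = 1" by (simp add: d)
    then have "F 1 i i = (\<Sum>l<k. q a l) + (\<Sum>l<k. q d l)"
      using i by (metis add q)
    also have "(\<Sum>l<k. q a l) = q a i + (\<Sum>l\<in>{..<k} - {i}. q a l)"
      using i by (simp add: sum.remove)
    finally have "F 1 i i = q a i + ((\<Sum>l\<in>{..<k} - {i}. q a l) + (\<Sum>l<k. q d l))"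
      by (simp add: add.assoc)
    moreover have "norm (q a i) \<le> norm (q a i + ((\<Sum>l\<in>{..<k} - {i}. q a l) + (\<Sum>l<k. q d l)))"
      by (intro norm_le_add_positive positive_cone_add positive_cone_sum pos)
    ultimately show ?thesis by (simp add: q_def cstar_identity)
  qed
  show ?thesis
  proof (cases "a = 0")
    case False
    define r where "r = norm a"
    have r: "r > 0" using False by (simp add: r_def)
    have "norm ((1 / r) *\<^sub>R a) \<le> 1" using r by (simp add: r_def)
    from unit[OF this] have "norm (F ((1 / r) *\<^sub>R a) i i) \<le> sqrt (norm (F 1 i i))"
      by (rule real_le_rsqrt)
    then show ?thesis using r i by (simp add: scaleR field_simps r_def)
  qed (use i zero in simp)
qed

end

section \<open>Passage between self-similar pairs and matrix entries\<close>

lemma mat_mult_entry: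
  "A \<in> carrier_mat k k \<Longrightarrow> B \<in> carrier_mat k k \<Longrightarrow> i < k \<Longrightarrow> j < k
    \<Longrightarrow> (A * B) $$ (i, j) = (\<Sum>l<k. A $$ (i, l) * B $$ (l, j))"
  by (simp add: scalar_prod_def atLeast0LessThan)

text \<open>The key is \<open>\<Phi> 1 = p\<close>: the projection lies in its own corner, so it is
  some \<open>\<Phi> e\<close>, and it acts as a left unit on the range of \<open>\<Phi>\<close>.
  Then onto-ness and density turn into \<open>surj\<close> and \<open>full\<close>.\<close>

lemma full_corner_of_self_similar_pair:
  fixes p :: "'a::unital_cstar_algebra mat"
  assumes "self_similar_pair p \<Phi>"
  obtains k where "full_corner k (\<lambda>a i j. \<Phi> a $$ (i, j))" "\<And>a. \<Phi> a \<in> carrier_mat k k"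
proof -
  obtain k where k: "k \<ge> 1" and proj: "mat_projection k p"
    and dense: "closure (cspan {sandwich a p b | a b. a \<in> carrier_vec k \<and> b \<in> carrier_vec k}) = UNIV"
    and iso: "star_iso_corner k p \<Phi>"
    using assms by (auto simp: self_similar_pair_def)
  have p: "p \<in> carrier_mat k k" "p * p = p" using proj by (auto simp: mat_projection_def)
  have bij: "bij_betw \<Phi> UNIV (corner k p)"
    and add: "\<Phi> (a + b) = \<Phi> a + \<Phi> b"
    and scale: "\<Phi> (c *\<^sub>C a) = map_mat (scaleC c) (\<Phi> a)"
    and mult: "\<Phi> (a * b) = \<Phi> a * \<Phi> b"
    and star: "\<Phi> (star a) = mat_star (\<Phi> a)" for a b c
    using iso by (auto simp: star_iso_corner_def)
  have corner: "\<exists>x \<in> carrier_mat k k. \<Phi> a = p * x * p" for a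
    using bij unfolding bij_betw_def corner_def by blast
  have carrier: "\<Phi> a \<in> carrier_mat k k" for a
    using corner[of a] p by auto
  have p_left: "p * \<Phi> a = \<Phi> a" for a
  proof -
    obtain x where x: "x \<in> carrier_mat k k" "\<Phi> a = p * x * p" using corner by blast
    have "p * (p * x * p) = (p * p) * x * p"
      using p(1) x(1) by (simp add: assoc_mult_mat[of _ k k _ k _ k])
    then show ?thesis by (simp add: x(2) p(2))
  qed
  have "p \<in> corner k p"
    unfolding corner_def using p by (auto intro!: exI[of _ p])
  then obtain e where e: "\<Phi> e = p" using bij unfolding bij_betw_def by (metis imageE)
  have one: "\<Phi> 1 = p" using mult[of e 1] p_left[of 1] e by simp
  show thesis
  proof (rule that[OF _ carrier], unfold_locales)
    show "k > 0" using k by simp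
    show "\<Phi> (a + b) $$ (i, j) = \<Phi> a $$ (i, j) + \<Phi> b $$ (i, j)" if "i < k" "j < k" for i j a b
      using that carrier[of a] carrier[of b] by (simp add: add)
    show "\<Phi> (c *\<^sub>C a) $$ (i, j) = c *\<^sub>C \<Phi> a $$ (i, j)" if "i < k" "j < k" for i j c a
      using that carrier[of a] by (simp add: scale)
    show "\<Phi> (a * b) $$ (i, j) = (\<Sum>l<k. \<Phi> a $$ (i, l) * \<Phi> b $$ (l, j))"
      if "i < k" "j < k" for i j a b
      unfolding mult using that carrier by (intro mat_mult_entry)
    show "\<Phi> (star a) $$ (i, j) = star (\<Phi> a $$ (j, i))" if "i < k" "j < k" for i j a
      using that carrier[of a] by (simp add: star mat_star_def)
    show "a = b" if "\<And>i j. i < k \<Longrightarrow> j < k \<Longrightarrow> \<Phi> a $$ (i, j) = \<Phi> b $$ (i, j)" for a b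
    proof -
      have "\<Phi> a = \<Phi> b" using that carrier[of a] carrier[of b] by (intro eq_matI) auto
      then show ?thesis using bij by (simp add: bij_betw_def inj_on_def)
    qed
    show "\<exists>a. \<forall>i<k. \<forall>j<k. \<Phi> a $$ (i, j)
        = (\<Sum>m<k. (\<Sum>l<k. \<Phi> 1 $$ (i, l) * x l m) * \<Phi> 1 $$ (m, j))" for x
    proof -
      define X where "X = mat k k (\<lambda>(l, m). x l m)"
      have X: "X \<in> carrier_mat k k" by (simp add: X_def)
      then have "p * X * p \<in> corner k p" by (auto simp: corner_def)
      then obtain a where a: "\<Phi> a = p * X * p" using bij unfolding bij_betw_def by (metis imageE)
      have pX: "p * X \<in> carrier_mat k k" using p(1) X by simp
      have "\<Phi> a $$ (i, j) = (\<Sum>m<k. (\<Sum>l<k. \<Phi> 1 $$ (i, l) * x l m) * \<Phi> 1 $$ (m, j))"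
        if "i < k" "j < k" for i j
        unfolding a one mat_mult_entry[OF pX p(1) that]
      proof (intro sum.cong refl)
        fix m assume "m \<in> {..<k}"
        then have "(p * X) $$ (i, m) = (\<Sum>l<k. p $$ (i, l) * X $$ (l, m))"
          using that(1) by (intro mat_mult_entry[OF p(1) X]) simp_all
        also have "\<dots> = (\<Sum>l<k. p $$ (i, l) * x l m)"
          using \<open>m \<in> {..<k}\<close> by (intro sum.cong refl) (simp add: X_def)
        finally show "(p * X) $$ (i, m) * p $$ (m, j) = (\<Sum>l<k. p $$ (i, l) * x l m) * p $$ (m, j)"
          by simp
      qed
      then show ?thesis by blast
    qed
    show "1 \<in> ideal_gen {\<Phi> 1 $$ (i, j) | i j. i < k \<and> j < k}"
      using dense by (simp add: one full_iff_ideal[OF p(1)])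
  qed
qed

text \<open>The matrix of \<open>F 1\<close> is a projection by multiplicativity and the star rule
  at \<open>1\<close>, and its corner is the range by \<open>surj\<close>.\<close>

lemma (in full_corner) self_similar_pair_mat:
  "self_similar_pair (mat k k (\<lambda>(i, j). F 1 i j)) (\<lambda>a. mat k k (\<lambda>(i, j). F a i j))"
proof -
  define \<Phi> where "\<Phi> a = mat k k (\<lambda>(i, j). F a i j)" for a
  have carrier: "\<Phi> a \<in> carrier_mat k k" for a by (simp add: \<Phi>_def)
  have entry: "i < k \<Longrightarrow> j < k \<Longrightarrow> \<Phi> a $$ (i, j) = F a i j" for a i j by (simp add: \<Phi>_def)
  have mult: "\<Phi> (a * b) = \<Phi> a * \<Phi> b" for a b
  proof (rule eq_matI)
    fix i j assume "i < dim_row (\<Phi> a * \<Phi> b)" "j < dim_col (\<Phi> a * \<Phi> b)"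
    then have ij: "i < k" "j < k" using carrier[of a] carrier[of b] by auto
    show "\<Phi> (a * b) $$ (i, j) = (\<Phi> a * \<Phi> b) $$ (i, j)"
      unfolding mat_mult_entry[OF carrier carrier ij] using ij by (simp add: entry local.mult)
  qed (simp_all add: \<Phi>_def)
  have star: "\<Phi> (star a) = mat_star (\<Phi> a)" for a
    unfolding mat_star_def by (rule eq_matI) (simp_all add: \<Phi>_def local.star)
  have inj: "inj \<Phi>"
  proof (rule injI, rule eqI)
    fix a b i j assume "\<Phi> a = \<Phi> b" "i < k" "j < k"
    then show "F a i j = F b i j" using entry[of i j a] entry[of i j b] by simp
  qed
  have "\<Phi> a \<in> corner k (\<Phi> 1)" for a
  proof -
    have "\<Phi> a = \<Phi> 1 * \<Phi> a * \<Phi> 1" by (metis mult mult_1_left mult_1_right)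
    then show ?thesis using carrier[of a] unfolding corner_def by blast
  qed
  moreover have "y \<in> range \<Phi>" if y: "y \<in> corner k (\<Phi> 1)" for y
  proof -
    obtain x where x: "x \<in> carrier_mat k k" "y = \<Phi> 1 * x * \<Phi> 1"
      using y unfolding corner_def by blast
    obtain a where a: "\<forall>i<k. \<forall>j<k. F a i j = (\<Sum>m<k. (\<Sum>l<k. F 1 i l * x $$ (l, m)) * F 1 m j)"
      using surj[of "\<lambda>l m. x $$ (l, m)"] by blast
    have px: "\<Phi> 1 * x \<in> carrier_mat k k" using carrier[of 1] x(1) by simp
    have "y = \<Phi> a"
    proof (rule eq_matI)
      fix i j assume "i < dim_row (\<Phi> a)" "j < dim_col (\<Phi> a)"
      then have ij: "i < k" "j < k" by (simp_all add: \<Phi>_def)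
      show "y $$ (i, j) = \<Phi> a $$ (i, j)"
        unfolding x(2) mat_mult_entry[OF px carrier ij]
        using ij by (simp add: entry a mat_mult_entry[OF carrier x(1)])
    qed (use x in \<open>simp_all add: \<Phi>_def\<close>)
    then show ?thesis by blast
  qed
  ultimately have bij: "bij_betw \<Phi> UNIV (corner k (\<Phi> 1))"
    using inj by (auto simp: bij_betw_def)
  have "star_iso_corner k (\<Phi> 1) \<Phi>"
    unfolding star_iso_corner_def
  proof (intro conjI allI bij mult star)
    show "\<Phi> (a + b) = \<Phi> a + \<Phi> b" for a b by (rule eq_matI) (simp_all add: \<Phi>_def add)
    show "\<Phi> (c *\<^sub>C a) = map_mat (scaleC c) (\<Phi> a)" for c a
      by (rule eq_matI) (simp_all add: \<Phi>_def scaleC)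
  qed
  moreover have "mat_projection k (\<Phi> 1)"
    unfolding mat_projection_def using carrier[of 1] mult[of 1 1] star[of 1] by simp
  moreover have "{\<Phi> 1 $$ (i, j) | i j. i < k \<and> j < k} = {F 1 i j | i j. i < k \<and> j < k}"
    by (metis (no_types, lifting) entry)
  then have "1 \<in> ideal_gen {\<Phi> 1 $$ (i, j) | i j. i < k \<and> j < k}" using full by simp
  ultimately have "self_similar_pair (\<Phi> 1) \<Phi>"
    unfolding self_similar_pair_def full_iff_ideal[OF carrier[of 1], symmetric]
    using size_pos by (intro exI[of _ k] conjI) simp_all
  then show ?thesis unfolding \<Phi>_def .
qed

definition trace_map ::
    "nat \<Rightarrow> ('a::unital_cstar_algebra \<Rightarrow> nat \<Rightarrow> nat \<Rightarrow> 'a) \<Rightarrow> ('a \<Rightarrow> complex) \<Rightarrow> ('a \<Rightarrow> complex)"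
  where "trace_map k F = (\<lambda>\<phi>\<in>bounded_traces. \<lambda>a. \<Sum>i<k. \<phi> (F a i i))"

lemma F_tr_eq: "F_tr = {trace_map k F | k F. full_corner k F}"
proof (intro equalityI subsetI)
  fix T :: "('a \<Rightarrow> complex) \<Rightarrow> ('a \<Rightarrow> complex)" assume "T \<in> F_tr"
  then obtain p \<Phi> where T: "T = induced_map (p, \<Phi>)" and "self_similar_pair p \<Phi>"
    by (auto simp: F_tr_def)
  obtain k where k: "full_corner k (\<lambda>a i j. \<Phi> a $$ (i, j))" "\<And>a. \<Phi> a \<in> carrier_mat k k"
    using full_corner_of_self_similar_pair[OF \<open>self_similar_pair p \<Phi>\<close>] by metis
  have "dim_row (\<Phi> a) = k" for a using k(2)[of a] by simp
  then have "T = trace_map k (\<lambda>a i j. \<Phi> a $$ (i, j))"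
    by (auto simp: T induced_map_def trace_map_def Tr_tensor_def fun_eq_iff restrict_def)
  then show "T \<in> {trace_map k F | k F. full_corner k F}" using k(1) by blast
next
  fix T :: "('a \<Rightarrow> complex) \<Rightarrow> ('a \<Rightarrow> complex)" assume "T \<in> {trace_map k F | k F. full_corner k F}"
  then obtain k F where T: "T = trace_map k F" and F: "full_corner k F" by blast
  have "T = induced_map (mat k k (\<lambda>(i, j). F 1 i j), \<lambda>a. mat k k (\<lambda>(i, j). F a i j))"
    by (auto simp: T induced_map_def trace_map_def Tr_tensor_def fun_eq_iff restrict_def)
  from conjI[OF this full_corner.self_similar_pair_mat[OF F]] show "T \<in> F_tr"
    unfolding F_tr_def mem_Collect_eq by (intro exI)
qed

subsection \<open>Composition of corners\<close>

text \<open>Indices below \<open>k * l\<close> correspond to pairs (block, position in the block),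
  via \<open>u = r + i * l\<close>.\<close>

lemma sum_div_mod:
  fixes f :: "nat \<Rightarrow> nat \<Rightarrow> 'b::comm_monoid_add"
  shows "(\<Sum>u<k * l. f (u div l) (u mod l)) = (\<Sum>i<k. \<Sum>r<l. f i r)"
proof -
  have "(\<Sum>u<k * l. f (u div l) (u mod l)) = (\<Sum>i<k. \<Sum>u\<in>{i * l..<i * l + l}. f (u div l) (u mod l))"
    by (rule sum.nat_group[symmetric])
  also have "\<dots> = (\<Sum>i<k. \<Sum>r<l. f i r)"
  proof (rule sum.cong[OF refl])
    fix i
    have "(\<Sum>u\<in>{i * l..<i * l + l}. f (u div l) (u mod l))
        = (\<Sum>r\<in>{0..<l}. f ((r + i * l) div l) ((r + i * l) mod l))"
      using sum.shift_bounds_nat_ivl[of "\<lambda>u. f (u div l) (u mod l)" 0 "i * l" l]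
      by (simp add: add.commute)
    also have "\<dots> = (\<Sum>r<l. f i r)"
      by (intro sum.cong) auto
    finally show "(\<Sum>u\<in>{i * l..<i * l + l}. f (u div l) (u mod l)) = (\<Sum>r<l. f i r)" .
  qed
  finally show ?thesis .
qed

lemma div_mod_less: "u < k * l \<Longrightarrow> u div l < k \<and> u mod l < (l::nat)"
  by (metis less_mult_imp_div_less mod_less_divisor mult_0_right not_less_zero gr0I)

lemma add_mult_less: "i < k \<Longrightarrow> r < l \<Longrightarrow> r + i * l < k * (l::nat)"
  by (metis add_less_cancel_right mult_Suc less_le_trans Suc_leI mult_le_mono1)

text \<open>A matrix of \<open>k\<close> by \<open>k\<close> blocks of size \<open>l\<close>, the
  block (i, j) being \<open>G\<close> applied to the entry \<open>F a i j\<close>.\<close>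

definition corner_comp ::
    "nat \<Rightarrow> ('a \<Rightarrow> nat \<Rightarrow> nat \<Rightarrow> 'a) \<Rightarrow> ('a \<Rightarrow> nat \<Rightarrow> nat \<Rightarrow> 'a) \<Rightarrow> 'a \<Rightarrow> nat \<Rightarrow> nat \<Rightarrow> 'a"
  where "corner_comp l G F a u v = G (F a (u div l) (v div l)) (u mod l) (v mod l)"

lemma full_corner_comp:
  fixes F G :: "'a::unital_cstar_algebra \<Rightarrow> nat \<Rightarrow> nat \<Rightarrow> 'a"
  assumes "full_corner k F" "full_corner l G"
  shows "full_corner (k * l) (corner_comp l G F)"
proof -
  interpret F: full_corner k F by fact
  interpret G: full_corner l G by fact
  have entry: "corner_comp l G F a (r + i * l) (s + j * l) = G (F a i j) r s"
    if "r < l" "s < l" for a i j r s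
    using that by (simp add: corner_comp_def)
  show ?thesis
  proof
    show "k * l > 0" using F.size_pos G.size_pos by simp
  next
    fix u v a b assume "u < k * l" "v < k * l"
    then show "corner_comp l G F (a + b) u v = corner_comp l G F a u v + corner_comp l G F b u v"
      by (simp add: corner_comp_def div_mod_less F.add G.add)
  next
    fix u v c a assume "u < k * l" "v < k * l"
    then show "corner_comp l G F (c *\<^sub>C a) u v = c *\<^sub>C corner_comp l G F a u v"
      by (simp add: corner_comp_def div_mod_less F.scaleC G.scaleC)
  next
    fix u v a b assume "u < k * l" "v < k * l"
    then show "corner_comp l G F (a * b) u v = (\<Sum>w<k * l. corner_comp l G F a u w * corner_comp l G F b w v)"
      using sum_div_mod[of "\<lambda>i r. G (F a (u div l) i) (u mod l) r * G (F b i (v div l)) r (v mod l)" l k]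
      by (simp add: corner_comp_def div_mod_less F.mult G.sum G.mult)
  next
    fix u v a assume "u < k * l" "v < k * l"
    then show "corner_comp l G F (star a) u v = star (corner_comp l G F a v u)"
      by (simp add: corner_comp_def div_mod_less F.star G.star)
  next
    fix a b
    assume eq: "\<And>u v. u < k * l \<Longrightarrow> v < k * l \<Longrightarrow> corner_comp l G F a u v = corner_comp l G F b u v"
    show "a = b"
    proof (rule F.eqI, rule G.eqI)
      fix i j r s assume "i < k" "j < k" "r < l" "s < l"
      then show "G (F a i j) r s = G (F b i j) r s"
        using eq[OF add_mult_less add_mult_less, of i r j s] by (simp only: entry)
    qed
  next
    fix x :: "nat \<Rightarrow> nat \<Rightarrow> 'a"
    \<comment> \<open>Preimages are taken in two stages: \<open>y i j\<close> for the block (i, j)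
      of \<open>x\<close> compressed by \<open>G 1\<close>, then \<open>a\<close> for the matrix
      \<open>y\<close> compressed by \<open>F 1\<close>.\<close>
    have "\<exists>y. \<forall>r<l. \<forall>s<l. G y r s
        = (\<Sum>t<l. (\<Sum>w<l. G 1 r w * x (w + i * l) (t + j * l)) * G 1 t s)" for i j
      by (rule G.surj)
    then have "\<forall>i j. \<exists>y. \<forall>r<l. \<forall>s<l. G y r s
        = (\<Sum>t<l. (\<Sum>w<l. G 1 r w * x (w + i * l) (t + j * l)) * G 1 t s)" by blast
    then obtain y where "\<forall>i j. \<forall>r<l. \<forall>s<l. G (y i j) r s
        = (\<Sum>t<l. (\<Sum>w<l. G 1 r w * x (w + i * l) (t + j * l)) * G 1 t s)"
      unfolding choice_iff by blast
    then have y: "G (y i j) r s = (\<Sum>t<l. (\<Sum>w<l. G 1 r w * x (w + i * l) (t + j * l)) * G 1 t s)"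
      if "r < l" "s < l" for i j r s using that by simp
    obtain a where a: "\<And>i j. i < k \<Longrightarrow> j < k \<Longrightarrow> F a i j = (\<Sum>m<k. (\<Sum>n<k. F 1 i n * y n m) * F 1 m j)"
      using F.surj[of y] by blast
    have absorb: "(\<Sum>t<l. G b r t * (\<Sum>w<l. G 1 t w * z w)) = (\<Sum>w<l. G b r w * z w)"
      if "r < l" for b r and z :: "nat \<Rightarrow> 'a"
    proof -
      have "(\<Sum>t<l. G b r t * (\<Sum>w<l. G 1 t w * z w)) = (\<Sum>w<l. (\<Sum>t<l. G b r t * G 1 t w) * z w)"
        unfolding sum_distrib_left sum_distrib_right mult.assoc by (rule sum.swap)
      then show ?thesis using that by (simp add: G.unit_right)
    qed
    have absorb': "(\<Sum>t<l. (\<Sum>w<l. z w * G 1 w t) * G b t s) = (\<Sum>w<l. z w * G b w s)"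
      if "s < l" for b s and z :: "nat \<Rightarrow> 'a"
    proof -
      have "(\<Sum>t<l. (\<Sum>w<l. z w * G 1 w t) * G b t s) = (\<Sum>w<l. z w * (\<Sum>t<l. G 1 w t * G b t s))"
        unfolding sum_distrib_left sum_distrib_right mult.assoc by (rule sum.swap)
      then show ?thesis using that by (simp add: G.unit_left)
    qed
    \<comment> \<open>The inner compression by \<open>G 1\<close> disappears between
      \<open>G b\<close> and \<open>G c\<close>, so only the block of \<open>x\<close>
      remains.\<close>
    have prod: "G (b * y n m * c) r s
        = (\<Sum>t<l. (\<Sum>w<l. G b r w * x (w + n * l) (t + m * l)) * G c t s)"
      if rs: "r < l" "s < l" for b c n m r s
    proof -
      define z where "z t = (\<Sum>w<l. G b r w * x (w + n * l) (t + m * l))" for t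
      have "G (b * y n m) r t = (\<Sum>t'<l. z t' * G 1 t' t)" if "t < l" for t
      proof -
        have "G (b * y n m) r t = (\<Sum>w<l. G b r w * (\<Sum>t'<l. (\<Sum>w'<l. G 1 w w' * x (w' + n * l) (t' + m * l)) * G 1 t' t))"
          using rs(1) that by (simp add: G.mult y)
        also have "\<dots> = (\<Sum>t'<l. (\<Sum>w<l. G b r w * (\<Sum>w'<l. G 1 w w' * x (w' + n * l) (t' + m * l))) * G 1 t' t)"
          unfolding sum_distrib_left[of "G b r _" _ "{..<l}"] sum_distrib_right[of _ _ "G 1 _ t"] mult.assoc[symmetric]
          by (rule sum.swap)
        finally show ?thesis unfolding absorb[OF rs(1)] z_def .
      qed
      then have "G (b * y n m * c) r s = (\<Sum>t<l. (\<Sum>t'<l. z t' * G 1 t' t) * G c t s)"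
        using rs by (simp add: G.mult)
      then show ?thesis unfolding absorb'[OF rs(2)] z_def .
    qed
    show "\<exists>a. \<forall>u<k * l. \<forall>v<k * l. corner_comp l G F a u v
        = (\<Sum>m<k * l. (\<Sum>n<k * l. corner_comp l G F 1 u n * x n m) * corner_comp l G F 1 m v)"
    proof (intro exI[of _ a] allI impI)
      fix u v assume "u < k * l" "v < k * l"
      define i r j s where "i = u div l" and "r = u mod l" and "j = v div l" and "s = v mod l"
      have lt: "i < k" "r < l" "j < k" "s < l"
        using \<open>u < k * l\<close> \<open>v < k * l\<close> by (simp_all add: i_def r_def j_def s_def div_mod_less)
      have "corner_comp l G F a u v = (\<Sum>m<k. \<Sum>n<k. G (F 1 i n * y n m * F 1 m j) r s)"
        using lt by (simp add: corner_comp_def a G.sum sum_distrib_right flip: i_def r_def j_def s_def)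
      also have "\<dots> = (\<Sum>m<k. \<Sum>n<k. \<Sum>t<l. (\<Sum>w<l. G (F 1 i n) r w * x (w + n * l) (t + m * l)) * G (F 1 m j) t s)"
        using lt by (simp add: prod)
      also have "\<dots> = (\<Sum>m<k. \<Sum>t<l. \<Sum>n<k. (\<Sum>w<l. G (F 1 i n) r w * x (w + n * l) (t + m * l)) * G (F 1 m j) t s)"
        by (intro sum.cong refl sum.swap)
      also have "\<dots> = (\<Sum>m<k. \<Sum>t<l. (\<Sum>n<k. \<Sum>w<l. G (F 1 i n) r w * x (w + n * l) (t + m * l)) * G (F 1 m j) t s)"
        by (simp add: sum_distrib_right)
      also have "\<dots> = (\<Sum>m<k. \<Sum>t<l. (\<Sum>n<k * l. corner_comp l G F 1 u n * x n (t + m * l)) * G (F 1 m j) t s)"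
        using sum_div_mod[of "\<lambda>n w. G (F 1 i n) r w * x (w + n * l) _" l k]
        by (simp add: corner_comp_def flip: i_def r_def j_def s_def)
      also have "\<dots> = (\<Sum>m<k * l. (\<Sum>n<k * l. corner_comp l G F 1 u n * x n m) * corner_comp l G F 1 m v)"
        using sum_div_mod[of "\<lambda>m t. (\<Sum>n<k * l. corner_comp l G F 1 u n * x n (t + m * l)) * G (F 1 m j) t s" l k]
        by (simp add: corner_comp_def flip: i_def r_def j_def s_def)
      finally show "corner_comp l G F a u v
        = (\<Sum>m<k * l. (\<Sum>n<k * l. corner_comp l G F 1 u n * x n m) * corner_comp l G F 1 m v)" .
    qed
  next
    let ?E = "{corner_comp l G F 1 u v | u v. u < k * l \<and> v < k * l}"
    \<comment> \<open>The case \<open>z = 1\<close> puts all entries of \<open>G 1\<close> into the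
      ideal, and these generate \<open>1\<close> by fullness of \<open>G\<close>.\<close>
    have "\<forall>r<l. \<forall>s<l. G z r s \<in> ideal_gen ?E"
      if "z \<in> ideal_gen {F 1 i j | i j. i < k \<and> j < k}" for z
      using that
    proof (induction rule: ideal_gen.induct)
      case (base z)
      then obtain i j where ij: "i < k" "j < k" "z = F 1 i j" by blast
      show ?case
      proof (intro allI impI)
        fix r s assume rs: "r < l" "s < l"
        have "corner_comp l G F 1 (r + i * l) (s + j * l) \<in> ideal_gen ?E"
          by (intro ideal_gen.base CollectI exI[of _ "r + i * l"] exI[of _ "s + j * l"] conjI refl
              add_mult_less ij rs)
        then show "G z r s \<in> ideal_gen ?E" by (simp add: entry rs ij(3))
      qed
    qed (auto simp: G.zero G.add G.mult intro!: ideal_gen.zero ideal_gen.add ideal_gen_sum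
        intro: ideal_gen.lmult ideal_gen.rmult)
    from this[OF F.full] have "{G 1 r s | r s. r < l \<and> s < l} \<subseteq> ideal_gen ?E" by blast
    then show "1 \<in> ideal_gen ?E" by (rule ideal_gen_minimal[OF _ G.full])
  qed
qed

subsection \<open>The inverse of a corner\<close>

context full_corner
begin

text \<open>The right module of columns fixed by the projection \<open>F 1\<close>; only the
  coordinates below \<open>k\<close> matter.\<close>

definition corner_vecs :: "(nat \<Rightarrow> 'a) set"
  where "corner_vecs = {v. \<forall>s<k. (\<Sum>r<k. F 1 s r * v r) = v s}"

definition ip :: "(nat \<Rightarrow> 'a) \<Rightarrow> (nat \<Rightarrow> 'a) \<Rightarrow> 'a"
  where "ip v w = (\<Sum>s<k. star (v s) * w s)"

lemma corner_vecs_mult: "v \<in> corner_vecs \<Longrightarrow> (\<lambda>s. v s * c) \<in> corner_vecs"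
  by (simp add: corner_vecs_def flip: sum_distrib_right mult.assoc)

lemma corner_vecs_add: "v \<in> corner_vecs \<Longrightarrow> w \<in> corner_vecs \<Longrightarrow> (\<lambda>s. v s + w s) \<in> corner_vecs"
  by (simp add: corner_vecs_def distrib_left sum.distrib)

lemma star_ip: "star (ip v w) = ip w v"
  by (simp add: ip_def star_sum star_mult star_star)

lemma ip_mult: "ip (\<lambda>s. v s * c) (\<lambda>s. w s * d) = star c * ip v w * d"
  by (simp add: ip_def star_mult sum_distrib_left sum_distrib_right mult.assoc)

lemma ip_self_positive: "ip v v \<in> positive_cone"
  unfolding ip_def by (intro positive_cone_sum positive_cone_star_mult)

text \<open>Mixed inner products are traded for a square up to a positive remainder.\<close>

lemma ip_polarization:
  "ip (\<lambda>s. v s + w s) (\<lambda>s. v s + w s)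
    = 2 *\<^sub>R (ip v w + ip w v) + ip (\<lambda>s. v s - w s) (\<lambda>s. v s - w s)"
proof -
  have "star (a + b) * (a + b) = 2 *\<^sub>R (star a * b + star b * a) + star (a - b) * (a - b)" for a b :: 'a
    by (simp add: star_add star_diff algebra_simps scaleR_2)
  then show ?thesis by (simp add: ip_def sum.distrib flip: scaleR_right.sum)
qed

text \<open>Entries of the projection are inner products of its columns; left and right multiples
  are absorbed into the first and second vector.\<close>

lemma ideal_gen_as_ip:
  assumes "z \<in> ideal_gen {F 1 i j | i j. i < k \<and> j < k}"
  shows "\<exists>xs. set xs \<subseteq> corner_vecs \<times> corner_vecs \<and> (\<Sum>(v, w)\<leftarrow>xs. ip v w) = z"
  using assms
proof (induction rule: ideal_gen.induct)
  case (base z)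
  then obtain i j where ij: "i < k" "j < k" "z = F 1 i j" by blast
  have "(\<lambda>s. F 1 s i) \<in> corner_vecs" "(\<lambda>s. F 1 s j) \<in> corner_vecs"
    using ij by (auto simp: corner_vecs_def unit_left)
  moreover have "ip (\<lambda>s. F 1 s i) (\<lambda>s. F 1 s j) = z"
    using ij by (simp add: ip_def star_unit unit_left)
  ultimately show ?case
    by (intro exI[of _ "[(\<lambda>s. F 1 s i, \<lambda>s. F 1 s j)]"]) simp
next
  case zero
  show ?case by (intro exI[of _ "[]"]) simp
next
  case (add x y)
  then obtain xs ys where
    "set xs \<subseteq> corner_vecs \<times> corner_vecs" "(\<Sum>(v, w)\<leftarrow>xs. ip v w) = x"
    "set ys \<subseteq> corner_vecs \<times> corner_vecs" "(\<Sum>(v, w)\<leftarrow>ys. ip v w) = y" by blast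
  then show ?case by (intro exI[of _ "xs @ ys"]) simp
next
  case (lmult x a)
  then obtain xs where xs: "set xs \<subseteq> corner_vecs \<times> corner_vecs" "(\<Sum>(v, w)\<leftarrow>xs. ip v w) = x" by blast
  have "ip (\<lambda>s. v s * star a) w = a * ip v w" for v w
    using ip_mult[of v "star a" w 1] by (simp add: star_star)
  then have "(\<Sum>(v, w)\<leftarrow>map (\<lambda>(v, w). (\<lambda>s. v s * star a, w)) xs. ip v w) = a * x"
    unfolding xs(2)[symmetric] by (simp add: case_prod_beta comp_def flip: sum_list_const_mult)
  moreover have "set (map (\<lambda>(v, w). (\<lambda>s. v s * star a, w)) xs) \<subseteq> corner_vecs \<times> corner_vecs"
    using xs(1) by (auto intro: corner_vecs_mult)
  ultimately show ?case by blast
next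
  case (rmult x a)
  then obtain xs where xs: "set xs \<subseteq> corner_vecs \<times> corner_vecs" "(\<Sum>(v, w)\<leftarrow>xs. ip v w) = x" by blast
  have "ip v (\<lambda>s. w s * a) = ip v w * a" for v w
    using ip_mult[of v 1 w a] by simp
  then have "(\<Sum>(v, w)\<leftarrow>map (\<lambda>(v, w). (v, \<lambda>s. w s * a)) xs. ip v w) = x * a"
    unfolding xs(2)[symmetric] by (simp add: case_prod_beta comp_def flip: sum_list_mult_const)
  moreover have "set (map (\<lambda>(v, w). (v, \<lambda>s. w s * a)) xs) \<subseteq> corner_vecs \<times> corner_vecs"
    using xs(1) by (auto intro: corner_vecs_mult)
  ultimately show ?case by blast
qed

text \<open>By polarization the sum of the \<open>ip (v + w) (v + w)\<close> is at least \<open>4\<close>, hence can be normalized.\<close>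

lemma frame_exists:
  obtains n :: nat and v where "n > 0" "\<And>t. t < n \<Longrightarrow> v t \<in> corner_vecs" "(\<Sum>t<n. ip (v t) (v t)) = 1"
proof -
  obtain xs where xs: "set xs \<subseteq> corner_vecs \<times> corner_vecs" "(\<Sum>(v, w)\<leftarrow>xs. ip v w) = 1"
    using ideal_gen_as_ip[OF full] by blast
  \<comment> \<open>The added zero pair leaves the sum unchanged and makes the list nonempty, as
    \<open>n > 0\<close> demands.\<close>
  define ys where "ys = (\<lambda>_. 0, \<lambda>_. 0) # xs"
  have "(\<lambda>_. 0) \<in> corner_vecs" by (simp add: corner_vecs_def)
  then have ys: "set ys \<subseteq> corner_vecs \<times> corner_vecs" using xs(1) by (simp add: ys_def)
  define n where "n = length ys"
  define v w where "v t = fst (ys ! t)" and "w t = snd (ys ! t)" for t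
  have vw: "v t \<in> corner_vecs" "w t \<in> corner_vecs" if "t < n" for t
  proof -
    have "ys ! t \<in> corner_vecs \<times> corner_vecs" using that ys nth_mem[of t ys] unfolding n_def by blast
    then show "v t \<in> corner_vecs" "w t \<in> corner_vecs" by (auto simp: v_def w_def)
  qed
  have one: "(\<Sum>t<n. ip (v t) (w t)) = 1"
  proof -
    have "(\<Sum>(v, w)\<leftarrow>ys. ip v w) = 1" using xs(2) by (simp add: ys_def ip_def)
    then show ?thesis
      by (simp add: sum_list_sum_nth atLeast0LessThan n_def v_def w_def case_prod_beta)
  qed
  then have "star (\<Sum>t<n. ip (v t) (w t)) = 1" by simp
  then have one': "(\<Sum>t<n. ip (w t) (v t)) = 1" by (simp add: star_sum star_ip)
  define q where "q t = (\<lambda>s. v t s + w t s)" for t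
  define h where "h = (\<Sum>t<n. ip (\<lambda>s. v t s - w t s) (\<lambda>s. v t s - w t s))"
  have "h \<in> positive_cone" unfolding h_def by (intro positive_cone_sum ip_self_positive)
  then obtain e where e: "star e = e" "e * (4 *\<^sub>R 1 + h) * e = 1"
    using inverse_sqrt_exists[of h 4] by (metis zero_less_numeral)
  \<comment> \<open>The two summands \<open>1\<close> are the sum of the mixed inner products and
    its adjoint.\<close>
  have "(\<Sum>t<n. ip (q t) (q t)) = 2 *\<^sub>R (1 + 1) + h"
    unfolding q_def ip_polarization sum.distrib by (simp add: scaleR_right.sum[symmetric] sum.distrib one one' h_def)
  also have "\<dots> = 4 *\<^sub>R 1 + h" by (simp add: scaleR_2[symmetric])
  finally have sum_q: "(\<Sum>t<n. ip (q t) (q t)) = 4 *\<^sub>R 1 + h" .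
  show thesis
  proof (rule that[of n "\<lambda>t s. q t s * e"])
    show "n > 0" by (simp add: n_def ys_def)
    show "(\<lambda>s. q t s * e) \<in> corner_vecs" if "t < n" for t
      unfolding q_def by (intro corner_vecs_mult corner_vecs_add vw that)
    show "(\<Sum>t<n. ip (\<lambda>s. q t s * e) (\<lambda>s. q t s * e)) = 1"
      using e by (simp add: ip_mult sum_q flip: sum_distrib_left sum_distrib_right)
  qed
qed

end

locale framed_corner = full_corner k F
  for k and F :: "'a::unital_cstar_algebra \<Rightarrow> nat \<Rightarrow> nat \<Rightarrow> 'a" +
  fixes n :: nat and v :: "nat \<Rightarrow> nat \<Rightarrow> 'a"
  assumes n_pos: "n > 0"
    and v_corner: "t < n \<Longrightarrow> v t \<in> corner_vecs"
    and frame: "(\<Sum>t<n. ip (v t) (v t)) = 1"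
begin

text \<open>The matrix being lifted is the column \<open>v i\<close> times \<open>a\<close> times
  the adjoint of \<open>v j\<close>; it lies in the corner because both vectors are fixed by
  \<open>F 1\<close>.\<close>

definition inv_corner :: "'a \<Rightarrow> nat \<Rightarrow> nat \<Rightarrow> 'a"
  where "inv_corner a i j = lift (\<lambda>r s. v i r * a * star (v j s))"

lemma v_left: "t < n \<Longrightarrow> s < k \<Longrightarrow> (\<Sum>r<k. F 1 s r * v t r) = v t s"
  using v_corner by (simp add: corner_vecs_def)

lemma v_right: "t < n \<Longrightarrow> s < k \<Longrightarrow> (\<Sum>r<k. star (v t r) * F 1 r s) = star (v t s)"
  using arg_cong[OF v_left, of t s star] by (simp add: star_sum star_mult star_unit)

text \<open>The normalized frame inserts a \<open>1\<close> between \<open>x\<close> and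
  \<open>y\<close>; the summands have the shape produced by entrywise products.\<close>

lemma frame_mult: "(\<Sum>t<n. \<Sum>m<k. x * star (v t m) * (v t m * y)) = x * y"
proof -
  have "(\<Sum>t<n. \<Sum>m<k. x * star (v t m) * (v t m * y)) = x * (\<Sum>t<n. ip (v t) (v t)) * y"
    by (simp add: ip_def sum_distrib_left sum_distrib_right mult.assoc)
  then show ?thesis by (simp add: frame)
qed

lemma F_inv_corner:
  assumes "i < n" "j < n" "r < k" "s < k"
  shows "F (inv_corner a i j) r s = v i r * a * star (v j s)"
  unfolding inv_corner_def
proof (rule F_lift)
  fix r s assume "r < k" "s < k"
  show "(\<Sum>l<k. F 1 r l * (v i l * a * star (v j s))) = v i r * a * star (v j s)"
    using v_left[OF \<open>i < n\<close> \<open>r < k\<close>] by (simp flip: mult.assoc sum_distrib_right)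
  show "(\<Sum>l<k. v i r * a * star (v j l) * F 1 l s) = v i r * a * star (v j s)"
    using v_right[OF \<open>j < n\<close> \<open>s < k\<close>] by (simp add: mult.assoc flip: sum_distrib_left)
qed (use assms in simp_all)

text \<open>The preimage of the column \<open>v t\<close> times row \<open>s\<close> of the
  projection; \<open>vec_col s t\<close> is its adjoint.\<close>

definition vec_row :: "nat \<Rightarrow> nat \<Rightarrow> 'a"
  where "vec_row t s = lift (\<lambda>r r'. v t r * F 1 s r')"

definition vec_col :: "nat \<Rightarrow> nat \<Rightarrow> 'a"
  where "vec_col s t = lift (\<lambda>r r'. F 1 r s * star (v t r'))"

lemma F_vec_row:
  assumes "t < n" "s < k" "r < k" "r' < k"
  shows "F (vec_row t s) r r' = v t r * F 1 s r'"
  unfolding vec_row_def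
proof (rule F_lift)
  fix r r' assume "r < k" "r' < k"
  show "(\<Sum>l<k. F 1 r l * (v t l * F 1 s r')) = v t r * F 1 s r'"
    using v_left[OF \<open>t < n\<close> \<open>r < k\<close>] by (simp flip: mult.assoc sum_distrib_right)
  show "(\<Sum>l<k. v t r * F 1 s l * F 1 l r') = v t r * F 1 s r'"
    using unit_left[OF \<open>s < k\<close> \<open>r' < k\<close>, of 1] by (simp add: mult.assoc flip: sum_distrib_left)
qed (use assms in simp_all)

lemma F_vec_col:
  assumes "t < n" "s < k" "r < k" "r' < k"
  shows "F (vec_col s t) r r' = F 1 r s * star (v t r')"
  unfolding vec_col_def
proof (rule F_lift)
  fix r r' assume "r < k" "r' < k"
  show "(\<Sum>l<k. F 1 r l * (F 1 l s * star (v t r'))) = F 1 r s * star (v t r')"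
    using unit_left[OF \<open>r < k\<close> \<open>s < k\<close>, of 1] by (simp flip: mult.assoc sum_distrib_right)
  show "(\<Sum>l<k. F 1 r s * star (v t l) * F 1 l r') = F 1 r s * star (v t r')"
    using v_right[OF \<open>t < n\<close> \<open>r' < k\<close>] by (simp add: mult.assoc flip: sum_distrib_left)
qed (use assms in simp_all)

text \<open>Under \<open>F\<close>, the sum over \<open>t\<close> collapses by the frame identity,
  and the sum over \<open>s\<close> then multiplies the projection by itself.\<close>

lemma sum_vec_col_row: "(\<Sum>s<k. \<Sum>t<n. vec_col s t * vec_row t s) = 1"
proof (rule eqI)
  fix r r' assume r: "r < k" "r' < k"
  have "F (\<Sum>s<k. \<Sum>t<n. vec_col s t * vec_row t s) r r'
      = (\<Sum>s<k. \<Sum>t<n. \<Sum>m<k. F 1 r s * star (v t m) * (v t m * F 1 s r'))"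
    using r by (simp add: sum mult F_vec_col F_vec_row)
  also have "\<dots> = F 1 r r'" using r by (simp add: frame_mult unit_left)
  finally show "F (\<Sum>s<k. \<Sum>t<n. vec_col s t * vec_row t s) r r' = F 1 r r'" .
qed

text \<open>This form of the diagonal entries of the composite lets a trace rotate
  \<open>vec_col s t\<close> to the front.\<close>

lemma inv_corner_eq:
  assumes "s < k" "t < n" shows "inv_corner (F a s s) t t = vec_row t s * a * vec_col s t"
proof (rule eqI)
  fix r r' assume r: "r < k" "r' < k"
  have "F (vec_row t s * a) r l = v t r * F a s l" if "l < k" for l
  proof -
    have "F (vec_row t s * a) r l = v t r * (\<Sum>m<k. F 1 s m * F a m l)"
      using r that assms by (simp add: mult F_vec_row sum_distrib_left mult.assoc)
    then show ?thesis using that assms by (simp add: unit_left)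
  qed
  then have "F (vec_row t s * a * vec_col s t) r r'
      = (\<Sum>l<k. v t r * F a s l * (F 1 l s * star (v t r')))"
    unfolding mult[OF r, of "vec_row t s * a"] using r assms by (simp add: F_vec_col)
  also have "\<dots> = v t r * (\<Sum>l<k. F a s l * F 1 l s) * star (v t r')"
    by (simp add: sum_distrib_left sum_distrib_right mult.assoc)
  finally have "F (vec_row t s * a * vec_col s t) r r'
      = v t r * (\<Sum>l<k. F a s l * F 1 l s) * star (v t r')" .
  then show "F (inv_corner (F a s s) t t) r r' = F (vec_row t s * a * vec_col s t) r r'"
    using r assms by (simp add: F_inv_corner unit_right)
qed

text \<open>Identities are checked after applying \<open>F\<close>; the frame identity removes the
  inner pair of vectors in each product.\<close>

lemma full_corner_inv_corner: "full_corner n inv_corner"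
proof
  show "n > 0" by (rule n_pos)
next
  fix i j a b assume ij: "i < n" "j < n"
  show "inv_corner (a + b) i j = inv_corner a i j + inv_corner b i j"
    by (rule eqI) (simp add: ij add F_inv_corner algebra_simps)
next
  fix i j c a assume ij: "i < n" "j < n"
  show "inv_corner (c *\<^sub>C a) i j = c *\<^sub>C inv_corner a i j"
    by (rule eqI) (simp add: ij scaleC F_inv_corner mult_scaleC_left mult_scaleC_right)
next
  fix i j a b assume ij: "i < n" "j < n"
  show "inv_corner (a * b) i j = (\<Sum>l<n. inv_corner a i l * inv_corner b l j)"
  proof (rule eqI)
    fix r s assume rs: "r < k" "s < k"
    have "F (\<Sum>l<n. inv_corner a i l * inv_corner b l j) r s
        = (\<Sum>l<n. \<Sum>m<k. v i r * a * star (v l m) * (v l m * (b * star (v j s))))"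
      using ij rs by (simp add: sum mult F_inv_corner mult.assoc)
    also have "\<dots> = F (inv_corner (a * b) i j) r s"
      unfolding frame_mult using ij rs by (simp add: F_inv_corner mult.assoc)
    finally show "F (inv_corner (a * b) i j) r s
        = F (\<Sum>l<n. inv_corner a i l * inv_corner b l j) r s" by simp
  qed
next
  fix i j a assume ij: "i < n" "j < n"
  show "inv_corner (star a) i j = star (inv_corner a j i)"
    by (rule eqI) (simp add: ij star F_inv_corner star_mult star_star mult.assoc)
next
  fix a b assume eq: "\<And>i j. i < n \<Longrightarrow> j < n \<Longrightarrow> inv_corner a i j = inv_corner b i j"
  \<comment> \<open>Multiplying by the frame vectors on both sides inverts
    \<open>inv_corner\<close>, which gives injectivity.\<close>
  have recover: "c = (\<Sum>i<n. \<Sum>r<k. \<Sum>j<n. \<Sum>s<k. star (v i r) * F (inv_corner c i j) r s * v j s)" for c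
  proof -
    have "(\<Sum>i<n. \<Sum>r<k. \<Sum>j<n. \<Sum>s<k. star (v i r) * F (inv_corner c i j) r s * v j s)
        = (\<Sum>i<n. \<Sum>r<k. \<Sum>j<n. \<Sum>s<k. (star (v i r) * v i r * c) * star (v j s) * (v j s * 1))"
      by (simp add: F_inv_corner mult.assoc)
    also have "\<dots> = (\<Sum>i<n. \<Sum>r<k. star (v i r) * v i r * c * 1)"
      by (simp only: frame_mult)
    also have "\<dots> = (\<Sum>i<n. \<Sum>r<k. 1 * star (v i r) * (v i r * c))"
      by (simp add: mult.assoc)
    also have "\<dots> = c" using frame_mult[of 1 c] by simp
    finally show ?thesis by simp
  qed
  show "a = b"
    by (rule trans[OF recover[of a] trans[OF _ recover[of b, symmetric]]]) (simp add: eq)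
next
  fix x :: "nat \<Rightarrow> nat \<Rightarrow> 'a"
  \<comment> \<open>The same inversion formula applied to \<open>x\<close> yields the preimage of
    its compression.\<close>
  define a where "a = (\<Sum>m<n. \<Sum>r'<k. (\<Sum>l<n. \<Sum>r<k. star (v l r) * F (x l m) r r') * v m r')"
  have "inv_corner a i j = (\<Sum>m<n. (\<Sum>l<n. inv_corner 1 i l * x l m) * inv_corner 1 m j)"
    if ij: "i < n" "j < n" for i j
  proof (rule eqI)
    fix s s' assume s: "s < k" "s' < k"
    have "F (\<Sum>l<n. inv_corner 1 i l * x l m) s r' = (\<Sum>l<n. \<Sum>r<k. v i s * star (v l r) * F (x l m) r r')"
      if "r' < k" for m r'
      using that ij s by (simp add: sum mult F_inv_corner)
    then have "F (\<Sum>m<n. (\<Sum>l<n. inv_corner 1 i l * x l m) * inv_corner 1 m j) s s'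
        = (\<Sum>m<n. \<Sum>r'<k. (\<Sum>l<n. \<Sum>r<k. v i s * star (v l r) * F (x l m) r r') * (v m r' * star (v j s')))"
      using ij s by (simp add: sum[of s s' _ "{..<n}"] mult[of s s' "sum _ _"] F_inv_corner)
    also have "\<dots> = v i s * a * star (v j s')"
      by (simp add: a_def sum_distrib_left sum_distrib_right mult.assoc)
    finally show "F (inv_corner a i j) s s'
        = F (\<Sum>m<n. (\<Sum>l<n. inv_corner 1 i l * x l m) * inv_corner 1 m j) s s'"
      using ij s by (simp add: F_inv_corner)
  qed
  then show "\<exists>a. \<forall>i<n. \<forall>j<n. inv_corner a i j
      = (\<Sum>m<n. (\<Sum>l<n. inv_corner 1 i l * x l m) * inv_corner 1 m j)" by blast
next
  let ?E = "{inv_corner 1 i j | i j. i < n \<and> j < n}"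
  \<comment> \<open>This puts each \<open>vec_col s t\<close> into the ideal, and with them
    \<open>1\<close>, by \<open>sum_vec_col_row\<close>.\<close>
  have col: "vec_col s t = (\<Sum>j<n. vec_col s j * inv_corner 1 j t)" if st: "s < k" "t < n" for s t
  proof (rule eqI)
    fix r r' assume r: "r < k" "r' < k"
    have "F (\<Sum>j<n. vec_col s j * inv_corner 1 j t) r r'
        = (\<Sum>j<n. \<Sum>m<k. F 1 r s * star (v j m) * (v j m * star (v t r')))"
      using r st by (simp add: sum mult F_vec_col F_inv_corner)
    then show "F (vec_col s t) r r' = F (\<Sum>j<n. vec_col s j * inv_corner 1 j t) r r'"
      using r st by (simp add: frame_mult F_vec_col)
  qed
  have "vec_col s t \<in> ideal_gen ?E" if "s < k" "t < n" for s t
  proof -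
    have "inv_corner 1 j t \<in> ideal_gen ?E" if "j < n" for j
      using that \<open>t < n\<close> by (intro ideal_gen.base CollectI exI[of _ j] exI[of _ t] conjI refl)
    then show ?thesis unfolding col[OF that] by (intro ideal_gen_sum ideal_gen.lmult) simp
  qed
  then have "(\<Sum>s<k. \<Sum>t<n. vec_col s t * vec_row t s) \<in> ideal_gen ?E"
    by (intro ideal_gen_sum ideal_gen.rmult) simp
  then show "1 \<in> ideal_gen ?E" by (simp only: sum_vec_col_row)
qed

end

subsection \<open>The induced maps on traces\<close>

lemma bounded_tracesD:
  assumes "\<phi> \<in> bounded_traces"
  shows "bounded_linear \<phi>" "\<phi> (c *\<^sub>C a) = c * \<phi> a" "\<phi> (a * b) = \<phi> (b * a)"
    "\<phi> (a + b) = \<phi> a + \<phi> b" "\<phi> (sum f A) = (\<Sum>x\<in>A. \<phi> (f x))"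
proof -
  show bl: "bounded_linear \<phi>" using assms by (simp add: bounded_traces_def)
  show "\<phi> (c *\<^sub>C a) = c * \<phi> a" "\<phi> (a * b) = \<phi> (b * a)"
    using assms by (auto simp: bounded_traces_def)
  interpret bounded_linear \<phi> by (rule bl)
  show "\<phi> (a + b) = \<phi> a + \<phi> b" by (rule add)
  show "\<phi> (sum f A) = (\<Sum>x\<in>A. \<phi> (f x))" by (rule sum)
qed

lemma bounded_traces_add:
  assumes "\<phi> \<in> bounded_traces" "\<psi> \<in> bounded_traces"
  shows "(\<lambda>a. \<phi> a + \<psi> a) \<in> bounded_traces"
  using bounded_tracesD[OF assms(1)] bounded_tracesD[OF assms(2)] unfolding bounded_traces_def
  by (simp add: bounded_linear_add distrib_left)

lemma bounded_traces_scale: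
  assumes "\<phi> \<in> bounded_traces"
  shows "(\<lambda>a. c * \<phi> a) \<in> bounded_traces"
  using bounded_tracesD[OF assms] unfolding bounded_traces_def
  by (simp add: bounded_linear_const_mult)

lemma mem_L_traces:
  "S \<in> carrier L_traces \<longleftrightarrow> S \<in> bounded_traces \<rightarrow>\<^sub>E bounded_traces \<and>
    (\<forall>\<phi>\<in>bounded_traces. \<forall>\<psi>\<in>bounded_traces. S (\<lambda>a. \<phi> a + \<psi> a) = (\<lambda>a. S \<phi> a + S \<psi> a)) \<and>
    (\<forall>c. \<forall>\<phi>\<in>bounded_traces. S (\<lambda>a. c * \<phi> a) = (\<lambda>a. c * S \<phi> a)) \<and>
    (\<exists>K. \<forall>\<phi>\<in>bounded_traces. onorm (S \<phi>) \<le> K * onorm \<phi>)"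
  by (simp add: L_traces_def)

lemma mult_L_traces: "S \<otimes>\<^bsub>L_traces\<^esub> T = compose bounded_traces S T"
  by (simp add: L_traces_def)

lemma one_L_traces: "\<one>\<^bsub>L_traces\<^esub> = (\<lambda>\<phi>\<in>bounded_traces. \<phi>)"
  by (simp add: L_traces_def)

context full_corner
begin

definition norm_const :: real
  where "norm_const = (\<Sum>i<k. sqrt (norm (F 1 i i)))"

text \<open>One estimate serves twice: it bounds each image functional and, through the factor
  \<open>onorm \<phi>\<close>, the map on the space of traces.\<close>

lemma trace_map_bound:
  assumes "\<phi> \<in> bounded_traces"
  shows "norm (\<Sum>i<k. \<phi> (F a i i)) \<le> (norm_const * onorm \<phi>) * norm a"
proof -
  have bl: "bounded_linear \<phi>" by (rule bounded_tracesD[OF assms])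
  have "norm (\<Sum>i<k. \<phi> (F a i i)) \<le> (\<Sum>i<k. onorm \<phi> * (sqrt (norm (F 1 i i)) * norm a))"
  proof (rule sum_norm_le)
    fix i assume "i \<in> {..<k}"
    then have "norm (F a i i) \<le> sqrt (norm (F 1 i i)) * norm a" by (intro bounded_diagonal) simp
    then show "norm (\<phi> (F a i i)) \<le> onorm \<phi> * (sqrt (norm (F 1 i i)) * norm a)"
      by (intro order_trans[OF onorm[OF bl]] mult_left_mono onorm_pos_le[OF bl])
  qed
  also have "\<dots> = (norm_const * onorm \<phi>) * norm a"
    by (simp add: norm_const_def sum_distrib_left sum_distrib_right mult_ac)
  finally show ?thesis .
qed

lemma trace_map_in_bounded_traces:
  assumes "\<phi> \<in> bounded_traces"
  shows "(\<lambda>a. \<Sum>i<k. \<phi> (F a i i)) \<in> bounded_traces"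
proof -
  note \<phi> = bounded_tracesD[OF assms]
  have scale: "(\<Sum>i<k. \<phi> (F (c *\<^sub>C a) i i)) = c * (\<Sum>i<k. \<phi> (F a i i))" for c a
    by (simp add: scaleC \<phi>(2) sum_distrib_left)
  have "bounded_linear (\<lambda>a. \<Sum>i<k. \<phi> (F a i i))"
  proof (rule bounded_linear_intro)
    show "(\<Sum>i<k. \<phi> (F (a + b) i i)) = (\<Sum>i<k. \<phi> (F a i i)) + (\<Sum>i<k. \<phi> (F b i i))" for a b
      by (simp add: add \<phi>(4) sum.distrib)
    show "(\<Sum>i<k. \<phi> (F (r *\<^sub>R a) i i)) = r *\<^sub>R (\<Sum>i<k. \<phi> (F a i i))" for r a
      by (simp only: scaleR_eq_scaleC[of r a] scale) (simp add: scaleR_conv_of_real)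
    show "norm (\<Sum>i<k. \<phi> (F a i i)) \<le> norm a * (norm_const * onorm \<phi>)" for a
      using trace_map_bound[OF assms, of a] by (simp add: mult.commute)
  qed
  moreover have "(\<Sum>i<k. \<phi> (F (a * b) i i)) = (\<Sum>i<k. \<phi> (F (b * a) i i))" for a b
  proof -
    have "(\<Sum>i<k. \<phi> (F (a * b) i i)) = (\<Sum>i<k. \<Sum>l<k. \<phi> (F a i l * F b l i))"
      by (simp add: mult \<phi>(5))
    also have "\<dots> = (\<Sum>l<k. \<Sum>i<k. \<phi> (F b l i * F a i l))"
      by (subst sum.swap) (simp only: \<phi>(3)[of "F a _ _"])
    also have "\<dots> = (\<Sum>l<k. \<phi> (F (b * a) l l))" by (simp add: mult \<phi>(5))
    finally show ?thesis .
  qed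
  ultimately show ?thesis unfolding bounded_traces_def using scale by blast
qed

lemma trace_map_in_L_traces: "trace_map k F \<in> carrier L_traces"
proof -
  have "onorm (trace_map k F \<phi>) \<le> norm_const * onorm \<phi>" if "\<phi> \<in> bounded_traces" for \<phi>
    unfolding trace_map_def using that trace_map_bound[OF that] bounded_tracesD(1)[OF that]
    by (simp add: onorm_bound onorm_pos_le norm_const_def sum_nonneg)
  then have "\<exists>K. \<forall>\<phi>\<in>bounded_traces. onorm (trace_map k F \<phi>) \<le> K * onorm \<phi>" by blast
  then show ?thesis
    unfolding mem_L_traces
    by (auto simp: trace_map_def trace_map_in_bounded_traces bounded_traces_add bounded_traces_scale sum.distrib sum_distrib_left)
qed

end

section \<open>Composition and inversion of the induced maps\<close>

lemma monoid_L_traces: "monoid (L_traces :: (('a::unital_cstar_algebra \<Rightarrow> complex) \<Rightarrow> ('a \<Rightarrow> complex)) monoid)"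
proof (rule monoidI)
  fix S T :: "('a \<Rightarrow> complex) \<Rightarrow> ('a \<Rightarrow> complex)"
  assume S: "S \<in> carrier L_traces" and T: "T \<in> carrier L_traces"
  obtain K where K: "\<And>\<phi>. \<phi> \<in> bounded_traces \<Longrightarrow> onorm (S \<phi>) \<le> K * onorm \<phi>"
    using S unfolding mem_L_traces by blast
  obtain K' where K': "\<And>\<phi>. \<phi> \<in> bounded_traces \<Longrightarrow> onorm (T \<phi>) \<le> K' * onorm \<phi>"
    using T unfolding mem_L_traces by blast
  have T_tr: "T \<phi> \<in> bounded_traces" if "\<phi> \<in> bounded_traces" for \<phi>
    using T that by (auto simp: L_traces_def)
  have "onorm (S (T \<phi>)) \<le> \<bar>K\<bar> * K' * onorm \<phi>" if \<phi>: "\<phi> \<in> bounded_traces" for \<phi>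
  proof -
    have "onorm (S (T \<phi>)) \<le> K * onorm (T \<phi>)" by (rule K[OF T_tr[OF \<phi>]])
    \<comment> \<open>The sign of \<open>K\<close> is unspecified, and the next estimate multiplies
      by a nonnegative constant.\<close>
    also have "\<dots> \<le> \<bar>K\<bar> * onorm (T \<phi>)"
      by (intro mult_right_mono onorm_pos_le bounded_tracesD(1)[OF T_tr[OF \<phi>]]) simp
    also have "\<dots> \<le> \<bar>K\<bar> * (K' * onorm \<phi>)" by (intro mult_left_mono K'[OF \<phi>]) simp
    finally show ?thesis by (simp add: mult.assoc)
  qed
  then have bound: "\<exists>K. \<forall>\<phi>\<in>bounded_traces. onorm (S (T \<phi>)) \<le> K * onorm \<phi>" by blast
  show "S \<otimes>\<^bsub>L_traces\<^esub> T \<in> carrier L_traces"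
    using S T bound unfolding mem_L_traces mult_L_traces
    by (auto simp: compose_def bounded_traces_add bounded_traces_scale T_tr PiE_iff)
next
  show "\<one>\<^bsub>L_traces\<^esub> \<in> carrier (L_traces :: (('a \<Rightarrow> complex) \<Rightarrow> ('a \<Rightarrow> complex)) monoid)"
    unfolding mem_L_traces one_L_traces
    by (auto simp: bounded_traces_add bounded_traces_scale intro!: exI[of _ 1])
next
  fix S T U :: "('a \<Rightarrow> complex) \<Rightarrow> ('a \<Rightarrow> complex)"
  assume "S \<in> carrier L_traces" "T \<in> carrier L_traces" "U \<in> carrier L_traces"
  then show "S \<otimes>\<^bsub>L_traces\<^esub> T \<otimes>\<^bsub>L_traces\<^esub> U = S \<otimes>\<^bsub>L_traces\<^esub> (T \<otimes>\<^bsub>L_traces\<^esub> U)"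
    by (auto simp: L_traces_def compose_def fun_eq_iff restrict_def)
next
  fix S :: "('a \<Rightarrow> complex) \<Rightarrow> ('a \<Rightarrow> complex)"
  assume S: "S \<in> carrier L_traces"
  show "\<one>\<^bsub>L_traces\<^esub> \<otimes>\<^bsub>L_traces\<^esub> S = S" "S \<otimes>\<^bsub>L_traces\<^esub> \<one>\<^bsub>L_traces\<^esub> = S"
    using S by (auto simp: L_traces_def compose_def fun_eq_iff restrict_def PiE_def extensional_def)
qed

text \<open>The diagonal of the block matrix runs through the diagonals of the blocks
  \<open>G (F a i i)\<close>. The map of \<open>G\<close> acts on the trace first, while
  \<open>F\<close> acts on the algebra element first.\<close>

lemma trace_map_comp:
  fixes F G :: "'a::unital_cstar_algebra \<Rightarrow> nat \<Rightarrow> nat \<Rightarrow> 'a"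
  assumes "full_corner l G"
  shows "compose bounded_traces (trace_map k F) (trace_map l G) = trace_map (k * l) (corner_comp l G F)"
proof -
  interpret full_corner l G by fact
  have "(\<Sum>i<k. \<Sum>r<l. \<phi> (G (F a i i) r r)) = (\<Sum>u<k * l. \<phi> (corner_comp l G F a u u))"
    for \<phi> :: "'a \<Rightarrow> complex" and a
    using sum_div_mod[of "\<lambda>i r. \<phi> (G (F a i i) r r)" l k] by (simp add: corner_comp_def)
  then show ?thesis
    by (auto simp: compose_def trace_map_def trace_map_in_bounded_traces fun_eq_iff)
qed

text \<open>Both composites are evaluated by cyclic rotation under the trace: one then reduces to
  \<open>sum_vec_col_row\<close>, the other to the frame identity.\<close>

lemma (in framed_corner) inverse_trace_maps:
  "compose bounded_traces (trace_map k F) (trace_map n inv_corner) = (\<lambda>\<phi>\<in>bounded_traces. \<phi>)"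
  "compose bounded_traces (trace_map n inv_corner) (trace_map k F) = (\<lambda>\<phi>\<in>bounded_traces. \<phi>)"
proof -
  interpret I: full_corner n inv_corner by (rule full_corner_inv_corner)
  have "(\<Sum>s<k. \<Sum>t<n. \<phi> (inv_corner (F a s s) t t)) = \<phi> a" if "\<phi> \<in> bounded_traces" for \<phi> a
  proof -
    note \<phi> = bounded_tracesD[OF that]
    have "\<phi> (inv_corner (F a s s) t t) = \<phi> (vec_col s t * vec_row t s * a)" if "s < k" "t < n" for s t
      using \<phi>(3)[of "vec_row t s * a" "vec_col s t"] by (simp add: inv_corner_eq[OF that] mult.assoc)
    then have "(\<Sum>s<k. \<Sum>t<n. \<phi> (inv_corner (F a s s) t t)) = (\<Sum>s<k. \<Sum>t<n. \<phi> (vec_col s t * vec_row t s * a))"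
      by simp
    also have "\<dots> = \<phi> ((\<Sum>s<k. \<Sum>t<n. vec_col s t * vec_row t s) * a)"
      by (simp only: \<phi>(5) sum_distrib_right)
    finally show ?thesis by (simp add: sum_vec_col_row)
  qed
  then show "compose bounded_traces (trace_map k F) (trace_map n inv_corner) = (\<lambda>\<phi>\<in>bounded_traces. \<phi>)"
    by (auto simp: compose_def trace_map_def I.trace_map_in_bounded_traces fun_eq_iff)
  have "(\<Sum>t<n. \<Sum>s<k. \<phi> (F (inv_corner a t t) s s)) = \<phi> a" if "\<phi> \<in> bounded_traces" for \<phi> a
  proof -
    note \<phi> = bounded_tracesD[OF that]
    have "(\<Sum>t<n. \<Sum>s<k. \<phi> (F (inv_corner a t t) s s)) = (\<Sum>t<n. \<Sum>s<k. \<phi> (1 * star (v t s) * (v t s * a)))"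
      by (simp add: F_inv_corner \<phi>(3)[of "v _ _ * a"])
    also have "\<dots> = \<phi> (\<Sum>t<n. \<Sum>s<k. 1 * star (v t s) * (v t s * a))"
      by (simp only: \<phi>(5))
    finally show ?thesis by (simp only: frame_mult) simp
  qed
  then show "compose bounded_traces (trace_map n inv_corner) (trace_map k F) = (\<lambda>\<phi>\<in>bounded_traces. \<phi>)"
    by (auto simp: compose_def trace_map_def trace_map_in_bounded_traces fun_eq_iff)
qed

section \<open>The subgroup property\<close>

lemma full_corner_trivial: "full_corner 1 (\<lambda>(a::'a::unital_cstar_algebra) i j. a)"
  by unfold_locales (auto intro: ideal_gen.base)

lemma F_trI: "full_corner k F \<Longrightarrow> trace_map k F \<in> F_tr"
  unfolding F_tr_eq mem_Collect_eq by (rule exI, rule exI, rule conjI[OF refl])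

lemma F_trE:
  assumes "T \<in> F_tr"
  obtains k F where "T = trace_map k F" "full_corner k F"
  using assms unfolding F_tr_eq mem_Collect_eq by (elim exE conjE)

theorem proposition3p5:
  shows "subgroup
    (F_tr :: (('a::unital_cstar_algebra \<Rightarrow> complex) \<Rightarrow> ('a \<Rightarrow> complex)) set) GL_traces"
proof -
  let ?L = "L_traces :: (('a \<Rightarrow> complex) \<Rightarrow> ('a \<Rightarrow> complex)) monoid"
  interpret L: monoid ?L by (rule monoid_L_traces)
  interpret GL: group "GL_traces :: (('a \<Rightarrow> complex) \<Rightarrow> ('a \<Rightarrow> complex)) monoid"
    unfolding GL_traces_def by (rule L.units_group)
  \<comment> \<open>Two-sided inverses inside \<open>F_tr\<close> yield both invertibility and
    closure under inversion.\<close>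
  have inv: "\<exists>S\<in>F_tr. T \<otimes>\<^bsub>?L\<^esub> S = \<one>\<^bsub>?L\<^esub> \<and> S \<otimes>\<^bsub>?L\<^esub> T = \<one>\<^bsub>?L\<^esub>"
    if "T \<in> F_tr" for T
  proof -
    obtain k and F :: "'a \<Rightarrow> nat \<Rightarrow> nat \<Rightarrow> 'a" where T: "T = trace_map k F" and F: "full_corner k F"
      using \<open>T \<in> F_tr\<close> by (rule F_trE)
    interpret full_corner k F by (rule F)
    obtain n :: nat and v where nv: "n > 0" "\<And>t. t < n \<Longrightarrow> v t \<in> corner_vecs" "(\<Sum>t<n. ip (v t) (v t)) = 1"
      using frame_exists by metis
    interpret framed_corner k F n v by unfold_locales (use nv in auto)
    have "trace_map n inv_corner \<in> F_tr" by (rule F_trI[OF full_corner_inv_corner])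
    then show ?thesis
      unfolding T mult_L_traces one_L_traces by (rule bexI[rotated]) (intro conjI inverse_trace_maps)
  qed
  have carrier: "T \<in> carrier ?L" if "T \<in> F_tr" for T
    using that by (auto elim!: F_trE intro: full_corner.trace_map_in_L_traces)
  have units: "F_tr \<subseteq> Units ?L"
  proof
    fix T :: "('a \<Rightarrow> complex) \<Rightarrow> ('a \<Rightarrow> complex)" assume T: "T \<in> F_tr"
    obtain S where S: "S \<in> F_tr" "T \<otimes>\<^bsub>?L\<^esub> S = \<one>\<^bsub>?L\<^esub>" "S \<otimes>\<^bsub>?L\<^esub> T = \<one>\<^bsub>?L\<^esub>"
      using inv[OF T] by auto
    then show "T \<in> Units ?L"
      unfolding Units_def using carrier[OF T] carrier[OF S(1)] by auto
  qed
  show ?thesis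
  proof (rule GL.subgroupI)
    show "F_tr \<subseteq> carrier (GL_traces :: (('a \<Rightarrow> complex) \<Rightarrow> ('a \<Rightarrow> complex)) monoid)"
      using units by (simp add: GL_traces_def units_of_carrier)
    \<comment> \<open>The identity map of the algebra, with \<open>k = 1\<close>, supplies an
      element.\<close>
    show "(F_tr :: (('a \<Rightarrow> complex) \<Rightarrow> ('a \<Rightarrow> complex)) set) \<noteq> {}"
      using F_trI[OF full_corner_trivial] by auto
  next
    fix T :: "('a \<Rightarrow> complex) \<Rightarrow> ('a \<Rightarrow> complex)" assume T: "T \<in> F_tr"
    obtain S where S: "S \<in> F_tr" "T \<otimes>\<^bsub>?L\<^esub> S = \<one>\<^bsub>?L\<^esub>" "S \<otimes>\<^bsub>?L\<^esub> T = \<one>\<^bsub>?L\<^esub>"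
      using inv[OF T] by auto
    have "inv\<^bsub>GL_traces\<^esub> T = S"
      using S T units by (intro GL.inv_equality) (auto simp: GL_traces_def units_of_def)
    then show "inv\<^bsub>GL_traces\<^esub> T \<in> F_tr" using S(1) by simp
  next
    fix S T :: "('a \<Rightarrow> complex) \<Rightarrow> ('a \<Rightarrow> complex)" assume S: "S \<in> F_tr" and T: "T \<in> F_tr"
    obtain k F where F: "S = trace_map k F" "full_corner k F" using S by (rule F_trE)
    obtain l G where G: "T = trace_map l G" "full_corner l G" using T by (rule F_trE)
    have "compose bounded_traces S T \<in> F_tr"
      unfolding F(1) G(1) trace_map_comp[OF G(2)] by (rule F_trI[OF full_corner_comp[OF F(2) G(2)]])
    then show "S \<otimes>\<^bsub>GL_traces\<^esub> T \<in> F_tr"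
      by (simp add: GL_traces_def units_of_mult mult_L_traces)
  qed
qed

end
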